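(* Let $u_0\in L^1(\mathbb R^N)$, $u_0\ge0$, and let $u$ be the semigroup solution of $\partial_t u+\mathcal L_{s,p}u=0$ with $u(\cdot,0)=u_0$. Then for every $t>0$, $$\int_{\mathbb R^N}u(x,t)\,dx=\int_{\mathbb R^N}u_0(x)\,dx .$$
   Context: Fix $N\ge1$, $0<s<1$, $p>2$, $\Phi(z)=|z|^{p-2}z$, $\mathcal L_{s,p}u(x)=\mathrm{P.V.}\int_{\mathbb R^N}\Phi(u(x)-u(y))|x-y|^{-(N+sp)}dy$. The semigroup solution with datum $u_0\in L^q(\mathbb R^N)$, $1\le q<\infty$, is the strong solution $u\in C([0,\infty);L^q)$ obtained from the $L^2$ gradient flow of $\mathcal J(u)=\frac1p\iint|u(x)-u(y)|^p|x-y|^{-(N+sp)}dxdy$, extended to ordered contraction semigroups in all $L^q$ that agree on common domains. *)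

theory Defs
  imports "HOL-Analysis.Analysis"
begin

text \<open>Functions on R^N are modelled as functions on a Euclidean space 'a, N = DIM('a),
  with Lebesgue measure. Time-dependent functions are u :: real => 'a => real, u t x = u(x,t).\<close>

definition Lq :: "real \<Rightarrow> ('a::euclidean_space \<Rightarrow> real) set" where
  "Lq q = {f. f \<in> borel_measurable lebesgue \<and>
              (\<integral>\<^sup>+ x. ennreal (\<bar>f x\<bar> powr q) \<partial>lebesgue) < \<infinity>}"

text \<open>q-th power of the L^q distance (as an extended nonnegative real).\<close>
definition Lq_dist :: "real \<Rightarrow> ('a::euclidean_space \<Rightarrow> real) \<Rightarrow> ('a \<Rightarrow> real) \<Rightarrow> ennreal" where
  "Lq_dist q f g = (\<integral>\<^sup>+ x. ennreal (\<bar>f x - g x\<bar> powr q) \<partial>lebesgue)"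

definition frac_energy :: "real \<Rightarrow> real \<Rightarrow> ('a::euclidean_space \<Rightarrow> real) \<Rightarrow> ennreal" where
  "frac_energy s p u = ennreal (1 / p) *
     (\<integral>\<^sup>+ z. ennreal (\<bar>u (fst z) - u (snd z)\<bar> powr p /
              norm (fst z - snd z) powr (real DIM('a) + s * p)) \<partial>(lebesgue \<Otimes>\<^sub>M lebesgue))"

definition frac_subdiff :: "real \<Rightarrow> real \<Rightarrow> ('a::euclidean_space \<Rightarrow> real) \<Rightarrow> ('a \<Rightarrow> real) \<Rightarrow> bool" where
  "frac_subdiff s p v w \<longleftrightarrow> v \<in> Lq 2 \<and> w \<in> Lq 2 \<and> frac_energy s p v < \<infinity> \<and>
     (\<forall>z \<in> Lq 2. frac_energy s p z < \<infinity> \<longrightarrow>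
        enn2real (frac_energy s p v) + (\<integral>x. w x * (z x - v x) \<partial>lebesgue)
          \<le> enn2real (frac_energy s p z))"

definition L2_gradient_flow ::
  "real \<Rightarrow> real \<Rightarrow> ('a::euclidean_space \<Rightarrow> real) \<Rightarrow> (real \<Rightarrow> 'a \<Rightarrow> real) \<Rightarrow> bool" where
  "L2_gradient_flow s p u0 u \<longleftrightarrow>
     u0 \<in> Lq 2 \<and>
     (\<forall>t\<ge>0. u t \<in> Lq 2) \<and>
     (AE x in lebesgue. u 0 x = u0 x) \<and>
     (\<forall>t\<ge>0. ((\<lambda>r. Lq_dist 2 (u r) (u t)) \<longlongrightarrow> 0) (at t within {0..})) \<and>
     (\<forall>\<delta>>0. \<exists>L. \<forall>r\<ge>\<delta>. \<forall>t\<ge>\<delta>. Lq_dist 2 (u r) (u t) \<le> ennreal ((L * \<bar>r - t\<bar>)\<^sup>2)) \<and>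
     (AE t in lborel. t > 0 \<longrightarrow>
        (\<exists>w. w \<in> Lq 2 \<and>
             ((\<lambda>h. Lq_dist 2 (\<lambda>x. (u (t + h) x - u t x) / h) w) \<longlongrightarrow> 0) (at 0) \<and>
             frac_subdiff s p (u t) (\<lambda>x. - w x)))"

text \<open>Semigroup solution with datum u0 \<in> L^1: u \<in> C([0,\<infinity>); L^1), u(0) = u0, and u(t) is the
  L^1-limit of the L^2 gradient-flow solutions with data in L^1 \<inter> L^2 approximating u0 in L^1
  (the extension of the L^2 semigroup to L^1 by density, agreeing on L^1 \<inter> L^2).\<close>
definition semigroup_solution_L1 ::
  "real \<Rightarrow> real \<Rightarrow> ('a::euclidean_space \<Rightarrow> real) \<Rightarrow> (real \<Rightarrow> 'a \<Rightarrow> real) \<Rightarrow> bool" where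
  "semigroup_solution_L1 s p u0 u \<longleftrightarrow>
     u0 \<in> Lq 1 \<and>
     (\<forall>t\<ge>0. u t \<in> Lq 1) \<and>
     (AE x in lebesgue. u 0 x = u0 x) \<and>
     (\<forall>t\<ge>0. ((\<lambda>r. Lq_dist 1 (u r) (u t)) \<longlongrightarrow> 0) (at t within {0..})) \<and>
     (\<exists>v0 :: nat \<Rightarrow> 'a \<Rightarrow> real. \<exists>v :: nat \<Rightarrow> real \<Rightarrow> 'a \<Rightarrow> real.
        (\<forall>n. v0 n \<in> Lq 1 \<and> v0 n \<in> Lq 2 \<and> L2_gradient_flow s p (v0 n) (v n)) \<and>
        (\<lambda>n. Lq_dist 1 (v0 n) u0) \<longlonglongrightarrow> 0 \<and>
        (\<forall>t\<ge>0. (\<lambda>n. Lq_dist 1 (v n t) (u t)) \<longlonglongrightarrow> 0))"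

end

theory Submission
  imports Defs
begin

text \<open>
  By density it suffices to treat an $L^2$ gradient flow \<open>v\<close> with datum in $L^1 \cap L^2$.
  Testing the equation with a cutoff \<open>\<phi>\<^sub>R\<close> leaves the flux term
  $\iint \Phi(v(x)-v(y))(\phi_R(x)-\phi_R(y))|x-y|^{-(N+sp)}$, which has to vanish as $R \to \infty$.
  The energy alone does not suffice for this when $sp \le N$, so \<open>v\<close> is simultaneously tested with the
  derivative of (a regularisation of) $|v|^\kappa$, $\kappa = 2 - 1/(p-1)$. Its dissipation absorbs
  the flux term up to a remainder
  $C_\eta \iint (|v(x)|+|v(y)|)\,|\phi_R(x)-\phi_R(y)|^p\,|x-y|^{-(N+sp)} \le C_\eta\, o(1)\, \|v\|_1$,
  and $\|v(t)\|_1 \le \|v_0\|_1$ follows by the same test with $\kappa = 1$ and no cutoff.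
  Hence $\pm\int v\phi_R + \eta \int |v|^\kappa - K_R t$ is nonincreasing in \<open>t\<close>, and one lets
  $R \to \infty$ and then $\eta \to 0$.
\<close>

text \<open>The exponent is forced by Young's inequality. With \<open>X = |v(x) - v(y)|\<close> and
  the weight \<open>q = |v(x)| + |v(y)| + \<delta>\<close>, the dissipation of |v|^\<kappa> controls
  \<open>X^p q^(\<kappa> - 2)\<close>, and splitting \<open>X^(p-1) D\<close> against it leaves
  \<open>q^((2 - \<kappa>)(p - 1)) D^p\<close>. This is linear in \<open>q\<close> exactly for
  \<open>\<kappa> = 2 - 1/(p - 1)\<close>, and \<open>p > 2\<close> puts \<kappa> strictly between 1
  and 2: above 1 the dissipation is genuine, below 2 the functional is finite for data in L^1 and
  L^2. The order of the limits is forced too. The parameter \<delta> makes the test function a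
  Lipschitz function of \<open>v\<close>, hence of finite energy, but it adds
  \<open>\<delta> E_R\<close> to the remainder, where the energy integral \<open>E_R\<close> of the
  cutoff scales like R^(N - sp). So \<delta> tends to 0 at fixed R. The Young constant is a multiple
  of \<eta>^(1 - p), so R tends to infinity at fixed \<eta>. The flow is given only by a
  subdifferential inequality and a time derivative at almost every time. Testing therefore means
  one-sided variations of the energy, and decay in time has to be read off from a derivative known
  almost everywhere.\<close>

section \<open>Preliminaries on the real line and Lebesgue measure\<close>

text \<open>Tilting \<open>f\<close> by a small slope makes its derivative strictly negative off a
  null set \<open>E\<close>. The local Lipschitz bounds make the image of \<open>E\<close> null, so
  some level between the end values is missed by that image. At the last point where the level is
  not exceeded the derivative is negative, yet the function lies above the level afterwards.\<close>

lemma AE_deriv_nonpos_imp_le: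
  fixes f :: "real \<Rightarrow> real"
  assumes "a < b" and cont: "continuous_on {a..b} f"
    and lip: "\<And>x. a < x \<Longrightarrow> x < b \<Longrightarrow> \<exists>T B. open T \<and> x \<in> T \<and> (\<forall>y\<in>T. \<bar>f y - f x\<bar> \<le> B * \<bar>y - x\<bar>)"
    and deriv: "AE x in lborel. a < x \<and> x < b \<longrightarrow> (\<exists>d\<le>0. (f has_real_derivative d) (at x))"
  shows "f b \<le> f a"
proof (rule ccontr)
  assume "\<not> f b \<le> f a"
  \<comment> \<open>Half the mean slope: the tilted \<open>g\<close> still rises from
    \<open>a\<close> to \<open>b\<close>, while its derivative off \<open>E\<close> is at most
    \<open>- c\<close>.\<close>
  define c where "c = (f b - f a) / (2 * (b - a))"
  have c: "c > 0" and cb: "f b - f a = 2 * c * (b - a)"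
    using \<open>a < b\<close> \<open>\<not> f b \<le> f a\<close> by (auto simp: c_def field_simps)
  define g where "g = (\<lambda>x. f x - c * x)"
  have "c * (b - a) > 0" using c \<open>a < b\<close> by simp
  then have gab: "g a < g b" using cb by (simp add: g_def algebra_simps)
  have contg: "continuous_on {a..b} g" unfolding g_def by (intro continuous_intros cont)
  define E where "E = {x. a < x \<and> x < b \<and> \<not> (\<exists>d\<le>0. (f has_real_derivative d) (at x))}"
  have "AE x in lebesgue. x \<notin> E"
    using AE_completion[OF deriv] by eventually_elim (auto simp: E_def)
  then have "negligible E"
    by (simp add: completion.AE_iff_null_sets negligible_iff_null_sets AE_iff_null_sets null_sets_def)
  have "negligible (g ` E)"
  proof (rule negligible_locally_Lipschitz_image[OF _ \<open>negligible E\<close>])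
    fix x assume "x \<in> E"
    then obtain T B where T: "open T" "x \<in> T" "\<forall>y\<in>T. \<bar>f y - f x\<bar> \<le> B * \<bar>y - x\<bar>"
      using lip[of x] by (auto simp: E_def)
    have "norm (g y - g x) \<le> (B + c) * norm (y - x)" if "y \<in> T" for y
    proof -
      have "\<bar>g y - g x\<bar> \<le> \<bar>f y - f x\<bar> + \<bar>c * (y - x)\<bar>" by (simp add: g_def algebra_simps)
      also have "\<dots> \<le> B * \<bar>y - x\<bar> + c * \<bar>y - x\<bar>" using T that c by (simp add: abs_mult)
      finally show ?thesis by (simp add: algebra_simps)
    qed
    then show "\<exists>T B. open T \<and> x \<in> T \<and> (\<forall>y\<in>E \<inter> T. norm (g y - g x) \<le> B * norm (y - x))"
      using T by blast
  qed simp
  have "\<not> {g a<..<g b} \<subseteq> g ` E"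
    using \<open>negligible (g ` E)\<close> negligible_subset gab
    by (metis box_real(1) negligible_interval(2) box_ne_empty(2) greaterThanLessThan_empty_iff not_le)
  then obtain y where y: "g a < y" "y < g b" "y \<notin> g ` E"
    unfolding subset_iff greaterThanLessThan_iff by blast
  define S where "S = {x \<in> {a..b}. g x \<le> y}"
  have "a \<in> S" using y \<open>a < b\<close> by (simp add: S_def)
  then have Sne: "S \<noteq> {}" by auto
  have "S = {a..b} \<inter> g -` {..y}" by (auto simp: S_def)
  then have "closed S" using continuous_closed_preimage[OF contg, of "{..y}"] by simp
  have bdd: "bdd_above S" by (auto simp: S_def)
  \<comment> \<open>The last point with \<open>g \<le> y\<close>. By continuity
    \<open>g x = y\<close>, and since \<open>y\<close> avoids the image of \<open>E\<close>, the
    derivative of \<open>f\<close> exists at \<open>x\<close> and is nonpositive.\<close>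
  define x where "x = Sup S"
  have "x \<in> S" unfolding x_def by (rule closed_contains_Sup[OF Sne bdd \<open>closed S\<close>])
  have above: "g z > y" if "x < z" "z \<le> b" for z
    using that \<open>x \<in> S\<close> cSup_upper[OF _ bdd, of z] by (force simp: S_def x_def not_le)
  have "x \<noteq> b" using y \<open>x \<in> S\<close> by (auto simp: S_def)
  then have "x < b" "x \<ge> a" "g x \<le> y" using \<open>x \<in> S\<close> by (auto simp: S_def)
  have "g x = y"
  proof (rule ccontr)
    assume "g x \<noteq> y"
    then have "\<exists>z\<ge>x. z \<le> b \<and> g z = y" using \<open>g x \<le> y\<close> y \<open>x < b\<close> \<open>x \<ge> a\<close>
      by (intro IVT') (auto intro: continuous_on_subset[OF contg])
    then show False using above \<open>g x \<noteq> y\<close> by force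
  qed
  then have "a < x" using y \<open>x \<ge> a\<close> by (cases "a = x") auto
  with \<open>x < b\<close> \<open>g x = y\<close> y obtain d where d: "d \<le> 0" "(f has_real_derivative d) (at x)"
    unfolding E_def by blast
  then have "(g has_real_derivative (d - c)) (at x)"
    unfolding g_def by (auto intro!: derivative_eq_intros)
  from DERIV_neg_dec_right[OF this] d c obtain e where e: "e > 0" "\<forall>h>0. h < e \<longrightarrow> g x > g (x + h)"
    by auto
  define h where "h = min (e/2) (b - x)"
  have "h > 0" "h < e" "x + h \<le> b" using e \<open>x < b\<close> by (auto simp: h_def)
  then show False using above[of "x + h"] e \<open>g x = y\<close> by force
qed

section \<open>Sigma-finiteness of Lebesgue measure and integrability of the truncated
  kernel\<close>

lemma sigma_finite_lebesgue: "sigma_finite_measure (lebesgue :: 'a::euclidean_space measure)"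
proof
  show "\<exists>A::'a set set. countable A \<and> A \<subseteq> sets lebesgue \<and> \<Union>A = space lebesgue \<and> (\<forall>a\<in>A. emeasure lebesgue a \<noteq> \<infinity>)"
  proof (intro exI conjI)
    show "countable (range (\<lambda>n::nat. ball (0::'a) (real n)))" by simp
    show "range (\<lambda>n::nat. ball (0::'a) (real n)) \<subseteq> sets lebesgue" by auto
    show "\<Union>(range (\<lambda>n::nat. ball (0::'a) (real n))) = space lebesgue"
      by (auto simp: reals_Archimedean2)
    show "\<forall>a\<in>range (\<lambda>n::nat. ball (0::'a) (real n)). emeasure lebesgue a \<noteq> \<infinity>"
      using emeasure_lborel_ball_finite[of "0::'a"] by (auto simp: less_top)
  qed
qed

text \<open>The volume of a ball scales like \<open>r k ^ DIM('a)\<close>, so the integrated series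
  is geometric with ratio \<open>2 powr (- \<beta>)\<close>. Radial integrals are estimated through
  such dyadic majorants.\<close>

lemma nn_integral_dyadic_finite:
  fixes C \<beta> :: real and a r :: "nat \<Rightarrow> real"
  assumes "\<beta> > 0" "C \<ge> 0"
    and "\<And>k. a k * r k ^ DIM('a) = C * 2 powr (- (real k * \<beta>))" "\<And>k. a k \<ge> 0" "\<And>k. r k \<ge> 0"
  shows "(\<integral>\<^sup>+ z. (\<Sum>k. ennreal (a k) * indicator (ball (0::'a::euclidean_space) (r k)) z) \<partial>lborel) < \<infinity>"
proof -
  let ?m = "measure lborel (ball (0::'a) 1)"
  have em: "emeasure lborel (ball (0::'a) (r k)) = ennreal (r k ^ DIM('a) * ?m)" for k
    using content_ball_conv_unit_ball[of "r k" "0::'a"] assms(5)[of k] emeasure_lborel_ball_finite[of "0::'a" "r k"]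
    by (simp add: emeasure_eq_ennreal_measure less_top)
  have "(\<integral>\<^sup>+ z. (\<Sum>k. ennreal (a k) * indicator (ball (0::'a) (r k)) z) \<partial>lborel)
      = (\<Sum>k. ennreal (a k) * emeasure lborel (ball (0::'a) (r k)))"
    by (subst nn_integral_suminf) (auto simp: nn_integral_cmult_indicator intro!: borel_measurable_times_ennreal borel_measurable_indicator)
  also have "\<dots> = (\<Sum>k. ennreal (C * ?m * (2 powr (-\<beta>)) ^ k))"
  proof (intro suminf_cong)
    fix k
    have "ennreal (a k) * emeasure lborel (ball (0::'a) (r k)) = ennreal (a k * (r k ^ DIM('a) * ?m))"
      using assms(4)[of k] assms(5)[of k] by (simp add: em ennreal_mult')
    also have "a k * (r k ^ DIM('a) * ?m) = C * ?m * 2 powr (- (real k * \<beta>))"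
      using assms(3)[of k] by (simp add: mult.assoc[symmetric])
    also have "2 powr (- (real k * \<beta>)) = (2 powr (-\<beta>)) ^ k"
      by (simp add: powr_powr flip: powr_realpow) (simp add: mult.commute)
    finally show "ennreal (a k) * emeasure lborel (ball (0::'a) (r k)) = ennreal (C * ?m * (2 powr (-\<beta>)) ^ k)" .
  qed
  also have "\<dots> = ennreal (\<Sum>k. C * ?m * (2 powr (-\<beta>)) ^ k)"
  proof (rule suminf_ennreal2)
    show "summable (\<lambda>k. C * ?m * (2 powr (-\<beta>)) ^ k)"
      using \<open>\<beta> > 0\<close> by (intro summable_mult summable_geometric) (simp add: powr_less_one)
  qed (use \<open>C \<ge> 0\<close> in auto)
  also have "\<dots> < \<infinity>" by simp
  finally show ?thesis .
qed

text \<open>Near the origin the integrand is |z|^((1-s)p - N), integrable because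
  \<open>s < 1\<close>; at infinity it is |z|^(-N - sp), integrable because \<open>s > 0\<close>.
  These two surpluses are the \<beta> of the two dyadic series \<open>A\<close> and
  \<open>B\<close>.\<close>

lemma cutoff_kernel_integrable:
  fixes s p :: real
  assumes "0 < s" "s < 1" "p > 0"
  shows "(\<integral>\<^sup>+ z. ennreal (min 1 (norm z) powr p / norm z powr (real DIM('a) + s * p)) \<partial>(lborel :: 'a::euclidean_space measure)) < \<infinity>"
proof -
  define N where "N = real DIM('a)"
  have "N > 0" by (simp add: N_def)
  have sp: "s * p > 0" "(1 - s) * p > 0" using assms by auto
  \<comment> \<open>\<open>a k\<close> bounds the integrand on the shell from
    \<open>2 powr (- k - 1)\<close> to \<open>2 powr (- k)\<close>, and \<open>b k\<close> bounds it
    on the shell from \<open>2 powr k\<close> to \<open>2 powr (k + 1)\<close>. Each shell is then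
    enlarged to the ball of its outer radius.\<close>
  define a where "a = (\<lambda>k::nat. 2 powr (- (real k * p)) * 2 powr ((real k + 1) * (N + s * p)))"
  define b where "b = (\<lambda>k::nat. 2 powr (- (real k * (N + s * p))))"
  define A where "A = (\<lambda>z::'a. \<Sum>k. ennreal (a k) * indicator (ball 0 (2 powr (- real k))) z)"
  define B where "B = (\<lambda>z::'a. \<Sum>k. ennreal (b k) * indicator (ball 0 (2 powr (real k + 1))) z)"
  have pw: "(2 powr x) ^ DIM('a) = 2 powr (x * N)" for x :: real
    by (simp add: powr_powr[symmetric] N_def powr_realpow)
  have fA: "(\<integral>\<^sup>+ z. A z \<partial>lborel) < \<infinity>" unfolding A_def
    by (rule nn_integral_dyadic_finite[where C = "2 powr (N + s * p)" and \<beta> = "(1 - s) * p"])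
       (use sp in \<open>auto simp: a_def pw powr_add[symmetric] algebra_simps\<close>)
  have fB: "(\<integral>\<^sup>+ z. B z \<partial>lborel) < \<infinity>" unfolding B_def
    by (rule nn_integral_dyadic_finite[where C = "2 powr N" and \<beta> = "s * p"])
       (use sp in \<open>auto simp: b_def pw powr_add[symmetric] algebra_simps\<close>)
  have le: "ennreal (min 1 (norm z) powr p / norm z powr (N + s * p)) \<le> A z + B z" for z :: 'a
  proof (cases "z = 0")
    case False
    define m where "m = \<lfloor>log 2 (norm z)\<rfloor>"
    have z: "norm z > 0" using False by simp
    have m1: "2 powr m \<le> norm z" using z le_log_iff[of 2 "norm z" m] by (auto simp: m_def)
    have m2: "norm z < 2 powr (m + 1)" using z log_less_iff[of 2 "norm z" "m + 1"] by (auto simp: m_def)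
    have den: "norm z powr (N + s * p) \<ge> 2 powr (m * (N + s * p))"
      using powr_mono2[OF _ _ m1, of "N + s * p"] \<open>N > 0\<close> sp by (simp add: powr_powr)
    show ?thesis
    proof (cases "m \<ge> 0")
      case True
      define k where "k = nat m"
      have mk: "real_of_int m = real k" using True by (simp add: k_def)
      have "min 1 (norm z) powr p / norm z powr (N + s * p) \<le> 1 / 2 powr (m * (N + s * p))"
        using den assms z by (intro frac_le) (auto intro!: powr_le1)
      also have "\<dots> = b k" by (simp add: b_def mk powr_minus divide_inverse)
      finally have "ennreal (min 1 (norm z) powr p / norm z powr (N + s * p))
          \<le> ennreal (b k) * indicator (ball 0 (2 powr (real k + 1))) z"
        using m2 mk by (auto simp: ennreal_leI)
      also have "\<dots> \<le> B z" unfolding B_def using sum_le_suminf[OF summableI, of "{k}"] by simp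
      also have "\<dots> \<le> A z + B z" by simp
      finally show ?thesis .
    next
      case False
      define k where "k = nat (- m - 1)"
      have mk: "real_of_int m = - real k - 1" using False by (simp add: k_def)
      have "min 1 (norm z) powr p \<le> (2 powr (- real k)) powr p"
        using m2 mk z assms by (intro powr_mono2) (auto simp: min_def)
      then have "min 1 (norm z) powr p / norm z powr (N + s * p) \<le> (2 powr (- real k)) powr p / 2 powr (m * (N + s * p))"
        using den by (intro frac_le) auto
      also have "\<dots> = a k"
        by (simp add: a_def mk powr_powr powr_minus[symmetric] divide_inverse powr_add[symmetric] algebra_simps)
      finally have "ennreal (min 1 (norm z) powr p / norm z powr (N + s * p))
          \<le> ennreal (a k) * indicator (ball 0 (2 powr (- real k))) z"
        using m2 mk by (auto simp: ennreal_leI)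
      also have "\<dots> \<le> A z" unfolding A_def using sum_le_suminf[OF summableI, of "{k}"] by simp
      also have "\<dots> \<le> A z + B z" by simp
      finally show ?thesis .
    qed
  qed simp
  have "(\<integral>\<^sup>+ z. ennreal (min 1 (norm z) powr p / norm z powr (real DIM('a) + s * p)) \<partial>(lborel :: 'a measure)) \<le> (\<integral>\<^sup>+ z. A z + B z \<partial>lborel)"
    using le by (intro nn_integral_mono) (simp add: N_def)
  also have "\<dots> = (\<integral>\<^sup>+ z. A z \<partial>lborel) + (\<integral>\<^sup>+ z. B z \<partial>lborel)"
    unfolding A_def B_def
    by (intro nn_integral_add; unfold measurable_lborel2;
        intro borel_measurable_suminf_order borel_measurable_times_ennreal borel_measurable_indicator; simp)
  also have "\<dots> < \<infinity>" using fA fB by simp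
  finally show ?thesis .
qed

section \<open>Pointwise inequalities\<close>

text \<open>For \<open>r = p - 1\<close> this is the nonlinearity \<Phi>(z) = |z|^(p-2) z of the
  operator.\<close>

definition odd_power :: "real \<Rightarrow> real \<Rightarrow> real" where
  "odd_power r x = sgn x * \<bar>x\<bar> powr r"

lemma DERIV_abs_powr:
  assumes "p > 1"
  shows "((\<lambda>x. \<bar>x\<bar> powr p) has_real_derivative p * odd_power (p - 1) x) (at x)"
proof -
  consider "x > 0" | "x < 0" | "x = 0" by linarith
  then show ?thesis
  proof cases
    case 1
    then have "((\<lambda>x. x powr p) has_real_derivative p * odd_power (p - 1) x) (at x)"
      by (auto intro!: derivative_eq_intros simp: odd_power_def)
    moreover have "\<forall>\<^sub>F y in nhds x. \<bar>y\<bar> powr p = y powr p"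
      using eventually_nhds_in_open[of "{0<..}" x] 1 by (auto elim!: eventually_mono)
    ultimately show ?thesis by (subst DERIV_cong_ev[OF refl _ refl]) auto
  next
    case 2
    then have "((\<lambda>x. (-x) powr p) has_real_derivative p * odd_power (p - 1) x) (at x)"
      by (auto intro!: derivative_eq_intros simp: odd_power_def)
    moreover have "\<forall>\<^sub>F y in nhds x. \<bar>y\<bar> powr p = (-y) powr p"
      using eventually_nhds_in_open[of "{..<0}" x] 2 by (auto elim!: eventually_mono)
    ultimately show ?thesis by (subst DERIV_cong_ev[OF refl _ refl]) auto
  next
    case 3
    \<comment> \<open>At the origin the difference quotient has absolute value
      \<open>\<bar>h\<bar> powr (p - 1)\<close>, which vanishes in the limit because
      \<open>p > 1\<close>.\<close>
    have "((\<lambda>h. \<bar>h\<bar> powr (p - 1)) \<longlongrightarrow> 0) (at (0::real))"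
      using assms by (auto intro!: tendsto_eq_intros)
    then have "((\<lambda>h. \<bar>h\<bar> powr p / h) \<longlongrightarrow> 0) (at (0::real))"
      by (rule Lim_null_comparison[rotated]) (auto simp: eventually_at powr_diff intro!: exI[of _ 1])
    with 3 show ?thesis by (simp add: DERIV_def odd_power_def)
  qed
qed

text \<open>The derivative is bounded only between the two points, so \<open>B\<close> may depend on
  them. This dependence later produces quadratic Taylor remainders.\<close>

lemma DERIV_bound_imp_Lipschitz:
  fixes f :: "real \<Rightarrow> real"
  assumes "\<And>x. (f has_real_derivative f' x) (at x)"
    and "\<And>x. min a b \<le> x \<Longrightarrow> x \<le> max a b \<Longrightarrow> \<bar>f' x\<bar> \<le> B"
  shows "\<bar>f a - f b\<bar> \<le> B * \<bar>a - b\<bar>"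
proof -
  have "norm (f a - f b) \<le> B * norm (a - b)"
    by (rule field_differentiable_bound[of "{min a b..max a b}" f f'])
       (use assms in \<open>auto intro: has_field_derivative_at_within\<close>)
  then show ?thesis by simp
qed

text \<open>The mean value point has modulus at most \<open>\<bar>A\<bar> + \<bar>B\<bar>\<close>
  because \<open>h \<le> 1\<close>. The right-hand side is free of \<open>h\<close> and, divided by
  the kernel, is integrable for functions of finite energy: it is the majorant for dominated
  convergence in \<open>frac_subdiff_test\<close>.\<close>

lemma abs_powr_diff_quotient_bound:
  fixes A B h p :: real
  assumes "p > 1" "0 < h" "h \<le> 1"
  shows "\<bar>(\<bar>A - h * B\<bar> powr p - \<bar>A\<bar> powr p) / (p * h)\<bar> \<le> 2 powr p * (\<bar>A\<bar> powr p + \<bar>B\<bar> powr p)"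
proof -
  let ?M = "\<bar>A\<bar> + \<bar>B\<bar>"
  have hB: "\<bar>h * B\<bar> \<le> \<bar>B\<bar>" using assms by (simp add: abs_mult mult_left_le_one_le)
  have "\<bar>\<bar>A - h * B\<bar> powr p - \<bar>A\<bar> powr p\<bar> \<le> (p * ?M powr (p - 1)) * \<bar>A - h * B - A\<bar>"
  proof (rule DERIV_bound_imp_Lipschitz[OF DERIV_abs_powr[OF \<open>p > 1\<close>]])
    fix x assume "min (A - h * B) A \<le> x" "x \<le> max (A - h * B) A"
    then have "\<bar>x\<bar> \<le> ?M" using hB by linarith
    then have "\<bar>x\<bar> powr (p - 1) \<le> ?M powr (p - 1)" using assms by (intro powr_mono2) auto
    moreover have "\<bar>odd_power (p - 1) x\<bar> \<le> \<bar>x\<bar> powr (p - 1)"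
      by (simp add: odd_power_def abs_mult abs_sgn_eq)
    ultimately show "\<bar>p * odd_power (p - 1) x\<bar> \<le> p * ?M powr (p - 1)"
      using assms by (simp add: abs_mult)
  qed
  also have "\<dots> = (?M powr (p - 1) * \<bar>B\<bar>) * (p * h)" using assms by (simp add: abs_mult)
  finally have "\<bar>(\<bar>A - h * B\<bar> powr p - \<bar>A\<bar> powr p) / (p * h)\<bar> \<le> ?M powr (p - 1) * \<bar>B\<bar>"
    using assms by (simp add: abs_mult divide_le_eq)
  also have "\<dots> \<le> ?M powr (p - 1) * ?M" by (intro mult_left_mono) auto
  also have "\<dots> = ?M powr p" by (cases "?M = 0") (auto simp: powr_mult_base[symmetric] powr_diff)
  also have "\<dots> \<le> (2 * max \<bar>A\<bar> \<bar>B\<bar>) powr p" using assms by (intro powr_mono2) auto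
  also have "\<dots> = 2 powr p * max \<bar>A\<bar> \<bar>B\<bar> powr p" by (simp add: powr_mult)
  also have "\<dots> \<le> 2 powr p * (\<bar>A\<bar> powr p + \<bar>B\<bar> powr p)" by (auto simp: max_def)
  finally show ?thesis .
qed

text \<open>A regularisation of $|r|^\kappa$ that vanishes at the origin and has a Lipschitz derivative, so that
  the derivative of \<open>\<integral> reg_power \<kappa> \<delta> \<circ> v\<close> is an admissible test function in the subdifferential inequality.\<close>

definition reg_power :: "real \<Rightarrow> real \<Rightarrow> real \<Rightarrow> real" where
  "reg_power \<kappa> \<delta> r = (r\<^sup>2 + \<delta>\<^sup>2) powr (\<kappa> / 2) - \<delta> powr \<kappa>"

definition reg_power_deriv :: "real \<Rightarrow> real \<Rightarrow> real \<Rightarrow> real" where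
  "reg_power_deriv \<kappa> \<delta> r = \<kappa> * r * (r\<^sup>2 + \<delta>\<^sup>2) powr (\<kappa> / 2 - 1)"

section \<open>Convexity, Taylor remainder and size of the regularised power\<close>

context
  fixes \<kappa> \<delta> :: real
  assumes kappa: "1 \<le> \<kappa>" "\<kappa> \<le> 2" and delta: "\<delta> > 0"
begin

lemma reg_base_pos: "r\<^sup>2 + \<delta>\<^sup>2 > 0" for r :: real
  using delta by (simp add: add_nonneg_pos)

lemma DERIV_reg_power: "(reg_power \<kappa> \<delta> has_real_derivative reg_power_deriv \<kappa> \<delta> r) (at r)"
  unfolding reg_power_def[abs_def] reg_power_deriv_def using reg_base_pos[of r]
  by (auto intro!: derivative_eq_intros)

lemma DERIV_reg_power_deriv:
  "(reg_power_deriv \<kappa> \<delta> has_real_derivative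
     \<kappa> * (r\<^sup>2 + \<delta>\<^sup>2) powr (\<kappa> / 2 - 2) * ((\<kappa> - 1) * r\<^sup>2 + \<delta>\<^sup>2)) (at r)"
proof -
  have "(reg_power_deriv \<kappa> \<delta> has_real_derivative
     \<kappa> * (r\<^sup>2 + \<delta>\<^sup>2) powr (\<kappa> / 2 - 1) + \<kappa> * r * ((\<kappa> / 2 - 1) * (r\<^sup>2 + \<delta>\<^sup>2) powr (\<kappa> / 2 - 2) * (2 * r))) (at r)"
    unfolding reg_power_deriv_def[abs_def] using reg_base_pos[of r]
    by (auto intro!: derivative_eq_intros)
  moreover have "(r\<^sup>2 + \<delta>\<^sup>2) powr (\<kappa> / 2 - 1) = (r\<^sup>2 + \<delta>\<^sup>2) * (r\<^sup>2 + \<delta>\<^sup>2) powr (\<kappa> / 2 - 2)"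
    using powr_mult_base[of "r\<^sup>2 + \<delta>\<^sup>2" "\<kappa> / 2 - 2"] reg_base_pos[of r] by simp
  ultimately show ?thesis by (simp add: algebra_simps power2_eq_square)
qed

text \<open>Both bounds come from \<open>(\<kappa> - 1) * S \<le> (\<kappa> - 1) * r\<^sup>2 +
  \<delta>\<^sup>2 \<le> S\<close> with \<open>S = r\<^sup>2 + \<delta>\<^sup>2\<close>; for the
  upper one, the nonpositive exponent \<open>\<kappa> / 2 - 1\<close> makes
  \<open>S = \<delta>\<^sup>2\<close> the worst case. The upper bound makes the test function
  admissible, the lower one is the convexity that yields dissipation.\<close>

lemma reg_power_second_deriv_bounds:
  fixes r :: real
  defines "D \<equiv> \<kappa> * (r\<^sup>2 + \<delta>\<^sup>2) powr (\<kappa> / 2 - 2) * ((\<kappa> - 1) * r\<^sup>2 + \<delta>\<^sup>2)"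
  shows "D \<le> 2 * \<delta> powr (\<kappa> - 2)" "D \<ge> (\<kappa> - 1) * (r\<^sup>2 + \<delta>\<^sup>2) powr (\<kappa> / 2 - 1)"
proof -
  let ?S = "r\<^sup>2 + \<delta>\<^sup>2"
  have e: "?S powr (\<kappa> / 2 - 1) = ?S powr (\<kappa> / 2 - 2) * ?S"
    using powr_mult_base[of "?S" "\<kappa> / 2 - 2"] reg_base_pos[of r] by (simp add: mult.commute)
  have "(\<kappa> - 1) * r\<^sup>2 \<le> 1 * r\<^sup>2" using kappa by (intro mult_right_mono) auto
  then have "D \<le> \<kappa> * ?S powr (\<kappa> / 2 - 2) * ?S" unfolding D_def using kappa
    by (intro mult_left_mono) auto
  also have "\<dots> = \<kappa> * ?S powr (\<kappa> / 2 - 1)" by (simp add: e)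
  also have "\<dots> \<le> 2 * (\<delta>\<^sup>2) powr (\<kappa> / 2 - 1)" using kappa delta
    by (intro mult_mono powr_mono2') auto
  also have "(\<delta>\<^sup>2) powr (\<kappa> / 2 - 1) = \<delta> powr (\<kappa> - 2)"
    using delta by (simp add: powr_powr algebra_simps flip: powr_numeral)
  finally show "D \<le> 2 * \<delta> powr (\<kappa> - 2)" .
  have "(\<kappa> - 1) * ?S \<le> (\<kappa> - 1) * r\<^sup>2 + \<delta>\<^sup>2"
    using mult_right_mono[of "\<kappa> - 1" 1 "\<delta>\<^sup>2"] kappa by (simp add: algebra_simps)
  then have "1 * ?S powr (\<kappa> / 2 - 2) * ((\<kappa> - 1) * ?S) \<le> D" unfolding D_def using kappa
    by (intro mult_mono) auto
  then show "D \<ge> (\<kappa> - 1) * ?S powr (\<kappa> / 2 - 1)" unfolding e by (simp add: mult_ac)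
qed

lemma reg_power_deriv_Lipschitz:
  "\<bar>reg_power_deriv \<kappa> \<delta> a - reg_power_deriv \<kappa> \<delta> b\<bar> \<le> 2 * \<delta> powr (\<kappa> - 2) * \<bar>a - b\<bar>"
proof (rule DERIV_bound_imp_Lipschitz[OF DERIV_reg_power_deriv])
  fix r :: real
  have "0 \<le> (\<kappa> - 1) * (r\<^sup>2 + \<delta>\<^sup>2) powr (\<kappa> / 2 - 1)" using kappa by simp
  with reg_power_second_deriv_bounds[of r]
  show "\<bar>\<kappa> * (r\<^sup>2 + \<delta>\<^sup>2) powr (\<kappa> / 2 - 2) * ((\<kappa> - 1) * r\<^sup>2 + \<delta>\<^sup>2)\<bar> \<le> 2 * \<delta> powr (\<kappa> - 2)"
    by linarith
qed

text \<open>The mean value point \<open>r\<close> satisfies \<open>r\<^sup>2 + \<delta>\<^sup>2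
  \<le> (\<bar>a\<bar> + \<bar>b\<bar> + \<delta>)\<^sup>2\<close>, and the second derivative is
  bounded below by a nonincreasing function of the left side. The weight is thus the one that enters
  Young's inequality.\<close>

lemma reg_power_deriv_increment:
  assumes "b \<le> a"
  shows "(\<kappa> - 1) * (\<bar>a\<bar> + \<bar>b\<bar> + \<delta>) powr (\<kappa> - 2) * (a - b) \<le> reg_power_deriv \<kappa> \<delta> a - reg_power_deriv \<kappa> \<delta> b"
proof (cases "a = b")
  case False
  with assms have "b < a" by simp
  from MVT2[OF this DERIV_reg_power_deriv] obtain r where r: "b < r" "r < a"
    "reg_power_deriv \<kappa> \<delta> a - reg_power_deriv \<kappa> \<delta> b
      = (a - b) * (\<kappa> * (r\<^sup>2 + \<delta>\<^sup>2) powr (\<kappa> / 2 - 2) * ((\<kappa> - 1) * r\<^sup>2 + \<delta>\<^sup>2))" by auto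
  let ?q = "\<bar>a\<bar> + \<bar>b\<bar> + \<delta>"
  have "\<bar>r\<bar> \<le> \<bar>a\<bar> + \<bar>b\<bar>" using r by linarith
  then have "r\<^sup>2 + \<delta>\<^sup>2 \<le> (\<bar>a\<bar> + \<bar>b\<bar>)\<^sup>2 + \<delta>\<^sup>2" by (simp add: abs_le_square_iff[symmetric])
  also have "\<dots> \<le> ?q\<^sup>2" using delta by (simp add: power2_sum)
  finally have "(?q\<^sup>2) powr (\<kappa> / 2 - 1) \<le> (r\<^sup>2 + \<delta>\<^sup>2) powr (\<kappa> / 2 - 1)"
    using kappa reg_base_pos[of r] by (intro powr_mono2') auto
  moreover have "(?q\<^sup>2) powr (\<kappa> / 2 - 1) = ?q powr (\<kappa> - 2)"
    using delta by (simp add: powr_powr algebra_simps flip: powr_numeral)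
  ultimately have "(\<kappa> - 1) * ?q powr (\<kappa> - 2) \<le> (\<kappa> - 1) * (r\<^sup>2 + \<delta>\<^sup>2) powr (\<kappa> / 2 - 1)"
    using kappa by (intro mult_left_mono) auto
  also note reg_power_second_deriv_bounds(2)[of r]
  finally show ?thesis using \<open>b < a\<close> by (simp add: r(3) mult.commute)
qed simp

lemma reg_power_zero [simp]: "reg_power \<kappa> \<delta> 0 = 0" "reg_power_deriv \<kappa> \<delta> 0 = 0"
proof -
  have "(\<delta>\<^sup>2) powr (\<kappa> / 2) = \<delta> powr \<kappa>" using delta by (simp add: powr_powr flip: powr_numeral)
  then show "reg_power \<kappa> \<delta> 0 = 0" "reg_power_deriv \<kappa> \<delta> 0 = 0"
    by (simp_all add: reg_power_def reg_power_deriv_def)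
qed

text \<open>Subtracting the tangent slope leaves a function whose derivative is
  \<open>O(\<bar>b - a\<bar>)\<close> on the segment, so the Lipschitz estimate gains a second
  factor \<open>\<bar>b - a\<bar>\<close>.\<close>

lemma reg_power_taylor:
  "\<bar>reg_power \<kappa> \<delta> b - reg_power \<kappa> \<delta> a - reg_power_deriv \<kappa> \<delta> a * (b - a)\<bar> \<le> 2 * \<delta> powr (\<kappa> - 2) * (b - a)\<^sup>2"
proof -
  let ?G = "reg_power_deriv \<kappa> \<delta>"
  have "\<bar>(reg_power \<kappa> \<delta> b - ?G a * b) - (reg_power \<kappa> \<delta> a - ?G a * a)\<bar> \<le> (2 * \<delta> powr (\<kappa> - 2) * \<bar>b - a\<bar>) * \<bar>b - a\<bar>"
  proof (rule DERIV_bound_imp_Lipschitz[where f = "\<lambda>x. reg_power \<kappa> \<delta> x - ?G a * x"])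
    show "((\<lambda>x. reg_power \<kappa> \<delta> x - ?G a * x) has_real_derivative ?G x - ?G a) (at x)" for x
      by (auto intro!: derivative_eq_intros DERIV_reg_power)
    fix x assume "min b a \<le> x" "x \<le> max b a"
    then have "\<bar>x - a\<bar> \<le> \<bar>b - a\<bar>" by linarith
    then have "2 * \<delta> powr (\<kappa> - 2) * \<bar>x - a\<bar> \<le> 2 * \<delta> powr (\<kappa> - 2) * \<bar>b - a\<bar>" by (intro mult_left_mono) auto
    with reg_power_deriv_Lipschitz[of x a]
    show "\<bar>?G x - ?G a\<bar> \<le> 2 * \<delta> powr (\<kappa> - 2) * \<bar>b - a\<bar>" by linarith
  qed
  moreover have "(2 * \<delta> powr (\<kappa> - 2) * \<bar>b - a\<bar>) * \<bar>b - a\<bar> = 2 * \<delta> powr (\<kappa> - 2) * (b - a)\<^sup>2"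
    by (simp only: mult.assoc abs_mult_self_eq power2_eq_square)
  moreover have "(reg_power \<kappa> \<delta> b - ?G a * b) - (reg_power \<kappa> \<delta> a - ?G a * a) = reg_power \<kappa> \<delta> b - reg_power \<kappa> \<delta> a - ?G a * (b - a)"
    by (simp add: algebra_simps)
  ultimately show ?thesis by simp
qed

lemma reg_power_nonneg: "reg_power \<kappa> \<delta> r \<ge> 0"
proof -
  have "(\<delta>\<^sup>2) powr (\<kappa> / 2) \<le> (r\<^sup>2 + \<delta>\<^sup>2) powr (\<kappa> / 2)" using kappa by (intro powr_mono2) auto
  moreover have "(\<delta>\<^sup>2) powr (\<kappa> / 2) = \<delta> powr \<kappa>" using delta by (simp add: powr_powr flip: powr_numeral)
  ultimately show ?thesis by (simp add: reg_power_def)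
qed

text \<open>Subadditivity of the power \<open>\<kappa> / 2 \<le> 1\<close>. The bound is uniform in
  \<delta>, unlike \<open>reg_power_le_quadratic\<close>, and so survives \<delta> tending to
  0.\<close>

lemma reg_power_le_abs_powr: "reg_power \<kappa> \<delta> r \<le> \<bar>r\<bar> powr \<kappa>"
proof -
  have sub: "(x + y) powr a \<le> x powr a + y powr a" if "x \<ge> 0" "y > 0" "0 \<le> a" "a \<le> 1" for x y a :: real
  proof -
    \<comment> \<open>Since \<open>a \<le> 1\<close>, enlarging the base of the power
      \<open>a - 1\<close> from \<open>z\<close> to \<open>x + y\<close> does not increase it.
      Adding the cases \<open>z = x\<close> and \<open>z = y\<close> gives subadditivity.\<close>
    have *: "z * (x + y) powr (a - 1) \<le> z powr a" if "0 \<le> z" "z \<le> x + y" for z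
    proof (cases "z = 0")
      case False
      then have "(x + y) powr (a - 1) \<le> z powr (a - 1)" using that \<open>a \<le> 1\<close> by (intro powr_mono2') auto
      then have "z * (x + y) powr (a - 1) \<le> z * z powr (a - 1)" using that by (intro mult_left_mono) auto
      also have "\<dots> = z powr a" using that by (simp add: powr_mult_base)
      finally show ?thesis .
    qed simp
    have "(x + y) powr a = (x + y) * (x + y) powr (a - 1)" using that by (simp add: powr_mult_base)
    also have "\<dots> \<le> x powr a + y powr a" using *[of x] *[of y] that by (simp add: distrib_right)
    finally show ?thesis .
  qed
  have "(r\<^sup>2 + \<delta>\<^sup>2) powr (\<kappa> / 2) \<le> (r\<^sup>2) powr (\<kappa> / 2) + (\<delta>\<^sup>2) powr (\<kappa> / 2)"
    using kappa delta by (intro sub) auto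
  moreover have "(\<delta>\<^sup>2) powr (\<kappa> / 2) = \<delta> powr \<kappa>" using delta by (simp add: powr_powr flip: powr_numeral)
  moreover have "(r\<^sup>2) powr (\<kappa> / 2) = \<bar>r\<bar> powr \<kappa>"
    using powr_powr[of "\<bar>r\<bar>" 2 "\<kappa> / 2"] by simp
  ultimately show ?thesis by (simp add: reg_power_def)
qed

text \<open>The power \<kappa> lies between 1 and 2, so |r|^\<kappa> is at most |r| on the unit
  interval and at most r^2 outside. For a datum in L^1 and L^2 this bounds the initial functional
  independently of \<delta>.\<close>

lemma reg_power_le: "reg_power \<kappa> \<delta> r \<le> \<bar>r\<bar> + r\<^sup>2"
proof -
  have "\<bar>r\<bar> powr \<kappa> \<le> \<bar>r\<bar> + r\<^sup>2"
  proof (cases "\<bar>r\<bar> \<le> 1")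
    case True
    then have "\<bar>r\<bar> powr \<kappa> \<le> \<bar>r\<bar> powr 1" using kappa powr_mono'[of 1 \<kappa> "\<bar>r\<bar>"] by simp
    then show ?thesis by simp (smt (verit) zero_le_power2)
  next
    case False
    then have "\<bar>r\<bar> powr \<kappa> \<le> \<bar>r\<bar> powr 2" using kappa by (intro powr_mono) auto
    then show ?thesis using False by simp
  qed
  then show ?thesis using reg_power_le_abs_powr[of r] by linarith
qed

text \<open>Gives integrability along the flow from L^2 alone, where membership in L^1 is not yet
  known.\<close>

lemma reg_power_le_quadratic: "reg_power \<kappa> \<delta> r \<le> 2 * \<delta> powr (\<kappa> - 2) * r\<^sup>2"
  using reg_power_taylor[of r 0] by simp

end

text \<open>Together with \<open>reg_power_le_abs_powr\<close> at exponent 1 this squeezes the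
  regularisation onto |r| as \<delta> tends to 0.\<close>

lemma reg_power_1_ge: "\<bar>r\<bar> - \<delta> \<le> reg_power 1 \<delta> r" if "\<delta> > 0"
proof -
  have "\<bar>r\<bar> \<le> sqrt (r\<^sup>2 + \<delta>\<^sup>2)" using real_sqrt_le_mono[of "r\<^sup>2" "r\<^sup>2 + \<delta>\<^sup>2"] by simp
  moreover have "(r\<^sup>2 + \<delta>\<^sup>2) powr (1 / 2) = sqrt (r\<^sup>2 + \<delta>\<^sup>2)" by (rule powr_half_sqrt) simp
  ultimately show ?thesis using that by (simp only: reg_power_def powr_one)
qed

text \<open>A dichotomy replaces the sharp Young inequality: below the threshold
  \<open>c * X * q powr (- 1 / (p - 1))\<close> for \<open>D\<close> the first term alone suffices,
  above it the second.\<close>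

lemma young_weighted:
  fixes X D q c p :: real
  assumes "X \<ge> 0" "D \<ge> 0" "q > 0" "c > 0" "p > 1"
  shows "X powr (p - 1) * D \<le> c * (X powr p * q powr (- 1 / (p - 1))) + c powr (1 - p) * (q * D powr p)"
proof (cases "D \<le> c * X * q powr (- 1 / (p - 1))")
  case True
  have e: "X powr (p - 1) * X = X powr p" using assms by (cases "X = 0") (auto simp: powr_diff)
  have "X powr (p - 1) * D \<le> X powr (p - 1) * (c * X * q powr (- 1 / (p - 1)))"
    using True by (intro mult_left_mono) auto
  also have "\<dots> = c * ((X powr (p - 1) * X) * q powr (- 1 / (p - 1)))" by (simp only: mult_ac)
  finally have "X powr (p - 1) * D \<le> c * (X powr p * q powr (- 1 / (p - 1)))"
    unfolding e .
  moreover have "0 \<le> c powr (1 - p) * (q * D powr p)" using assms by simp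
  ultimately show ?thesis by linarith
next
  case False
  have "q powr (1 / (p - 1)) * q powr (- 1 / (p - 1)) = 1" using assms by (simp flip: powr_add)
  then have "c * X = (c * X * q powr (- 1 / (p - 1))) * q powr (1 / (p - 1))"
    by (simp add: mult.commute mult.left_commute)
  also have "\<dots> \<le> D * q powr (1 / (p - 1))" using False by (intro mult_right_mono) auto
  \<comment> \<open>Raising this to the power \<open>p - 1\<close> turns
    \<open>q powr (1 / (p - 1))\<close> into \<open>q\<close>, which is why the second term is
    linear in the weight.\<close>
  finally have "X \<le> D * q powr (1 / (p - 1)) / c" using assms by (simp add: field_simps)
  then have "X powr (p - 1) \<le> (D * q powr (1 / (p - 1)) / c) powr (p - 1)"
    using assms by (intro powr_mono2) auto
  also have "\<dots> = D powr (p - 1) * q * c powr (1 - p)"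
  proof -
    have "(D * q powr (1 / (p - 1)) / c) powr (p - 1) = D powr (p - 1) * q / c powr (p - 1)"
      using assms by (simp only: powr_divide powr_mult powr_powr) simp
    also have "\<dots> = D powr (p - 1) * q * c powr (1 - p)"
      using powr_minus[of c "p - 1"] by (simp add: divide_inverse)
    finally show ?thesis .
  qed
  finally have "X powr (p - 1) * D \<le> (D powr (p - 1) * q * c powr (1 - p)) * D"
    using assms by (intro mult_right_mono) auto
  also have "\<dots> = (D powr (p - 1) * D) * (c powr (1 - p) * q)" by (simp add: mult_ac)
  also have "D powr (p - 1) * D = D powr p" using assms by (cases "D = 0") (auto simp: powr_diff)
  finally have "X powr (p - 1) * D \<le> c powr (1 - p) * (q * D powr p)" by (simp add: mult_ac)
  moreover have "0 \<le> c * (X powr p * q powr (- 1 / (p - 1)))" using assms by simp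
  ultimately show ?thesis by linarith
qed

text \<open>Both sides are invariant under exchanging \<open>a\<close> and \<open>b\<close>, so
  \<open>b \<le> a\<close> may be assumed, and there \<open>reg_power_deriv_increment\<close>
  applies. For \<open>\<kappa> = 1\<close> only the sign remains, which is all the L^1 bound uses;
  for \<open>\<kappa> > 1\<close> it is the dissipation.\<close>

lemma odd_power_mult_reg_power_deriv:
  assumes "1 \<le> \<kappa>" "\<kappa> \<le> 2" "\<delta> > 0" "p > 1"
  shows "(\<kappa> - 1) * (\<bar>a - b\<bar> powr p * (\<bar>a\<bar> + \<bar>b\<bar> + \<delta>) powr (\<kappa> - 2))
       \<le> odd_power (p - 1) (a - b) * (reg_power_deriv \<kappa> \<delta> a - reg_power_deriv \<kappa> \<delta> b)"
proof -
  have *: "(\<kappa> - 1) * (\<bar>a - b\<bar> powr p * (\<bar>a\<bar> + \<bar>b\<bar> + \<delta>) powr (\<kappa> - 2))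
       \<le> odd_power (p - 1) (a - b) * (reg_power_deriv \<kappa> \<delta> a - reg_power_deriv \<kappa> \<delta> b)" if "b \<le> a" for a b
  proof -
    have e: "\<bar>a - b\<bar> powr p = \<bar>a - b\<bar> powr (p - 1) * (a - b)"
      using that by (cases "a = b") (auto simp: powr_diff)
    have o: "odd_power (p - 1) (a - b) = \<bar>a - b\<bar> powr (p - 1)"
      using that by (cases "a = b") (auto simp: odd_power_def)
    have "\<bar>a - b\<bar> powr (p - 1) * ((\<kappa> - 1) * (\<bar>a\<bar> + \<bar>b\<bar> + \<delta>) powr (\<kappa> - 2) * (a - b))
       \<le> \<bar>a - b\<bar> powr (p - 1) * (reg_power_deriv \<kappa> \<delta> a - reg_power_deriv \<kappa> \<delta> b)"
      using that assms by (intro mult_left_mono reg_power_deriv_increment) auto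
    then show ?thesis by (simp add: e o mult_ac)
  qed
  show ?thesis
  proof (cases "b \<le> a")
    case False
    moreover have "odd_power (p - 1) (a - b) = - odd_power (p - 1) (b - a)"
      by (simp add: odd_power_def abs_minus_commute sgn_if)
    moreover have "reg_power_deriv \<kappa> \<delta> a - reg_power_deriv \<kappa> \<delta> b = - (reg_power_deriv \<kappa> \<delta> b - reg_power_deriv \<kappa> \<delta> a)"
      by simp
    moreover have "\<bar>a\<bar> + \<bar>b\<bar> + \<delta> = \<bar>b\<bar> + \<bar>a\<bar> + \<delta>" "\<bar>a - b\<bar> = \<bar>b - a\<bar>" by auto
    ultimately show ?thesis using *[of a b] by (simp only: minus_mult_minus)
  qed (rule *)
qed

text \<open>The exponent \<open>\<kappa>\<close> is chosen so that the weight left over by Young's inequality is linear in \<open>a\<close>, \<open>b\<close>,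
  and hence controlled by the $L^1$ norm.\<close>

lemma dissipation_pointwise:
  fixes a b D \<eta> \<delta> p :: real
  defines "\<kappa> \<equiv> 2 - 1 / (p - 1)"
  assumes "p > 2" "\<eta> > 0" "\<delta> > 0"
  shows "- odd_power (p - 1) (a - b) * (D + \<eta> * (reg_power_deriv \<kappa> \<delta> a - reg_power_deriv \<kappa> \<delta> b))
      \<le> (\<eta> * (\<kappa> - 1)) powr (1 - p) * ((\<bar>a\<bar> + \<bar>b\<bar> + \<delta>) * \<bar>D\<bar> powr p)"
proof -
  have k: "1 < \<kappa>" "\<kappa> \<le> 2" using assms by (auto simp: \<kappa>_def field_simps)
  let ?q = "\<bar>a\<bar> + \<bar>b\<bar> + \<delta>" and ?X = "\<bar>a - b\<bar>"
  have "\<kappa> - 2 = - 1 / (p - 1)" by (simp add: \<kappa>_def)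
  \<comment> \<open>With Young's parameter equal to \<open>\<eta> * (\<kappa> - 1)\<close> the first
    term on the right is exactly what the dissipation estimate below cancels.\<close>
  then have "?X powr (p - 1) * \<bar>D\<bar> \<le> \<eta> * (\<kappa> - 1) * (?X powr p * ?q powr (\<kappa> - 2))
      + (\<eta> * (\<kappa> - 1)) powr (1 - p) * (?q * \<bar>D\<bar> powr p)"
    using young_weighted[of ?X "\<bar>D\<bar>" ?q "\<eta> * (\<kappa> - 1)" p] k assms by simp
  moreover have "\<eta> * ((\<kappa> - 1) * (?X powr p * ?q powr (\<kappa> - 2)))
      \<le> \<eta> * (odd_power (p - 1) (a - b) * (reg_power_deriv \<kappa> \<delta> a - reg_power_deriv \<kappa> \<delta> b))"
    using k assms by (intro mult_left_mono odd_power_mult_reg_power_deriv) auto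
  moreover have "- odd_power (p - 1) (a - b) * D \<le> ?X powr (p - 1) * \<bar>D\<bar>"
  proof -
    have "\<bar>odd_power (p - 1) (a - b)\<bar> \<le> ?X powr (p - 1)" by (simp add: odd_power_def abs_mult abs_sgn_eq)
    then have "\<bar>odd_power (p - 1) (a - b)\<bar> * \<bar>D\<bar> \<le> ?X powr (p - 1) * \<bar>D\<bar>" by (intro mult_right_mono) auto
    moreover have "- odd_power (p - 1) (a - b) * D \<le> \<bar>odd_power (p - 1) (a - b)\<bar> * \<bar>D\<bar>"
      using abs_ge_minus_self[of "odd_power (p - 1) (a - b) * D"] by (simp add: abs_mult)
    ultimately show ?thesis by linarith
  qed
  ultimately show ?thesis by (simp add: algebra_simps)
qed

section \<open>Functionals along curves in $L^2$\<close>

lemma Lq_2_iff: "f \<in> Lq 2 \<longleftrightarrow> f \<in> borel_measurable lebesgue \<and> integrable lebesgue (\<lambda>x. (f x)\<^sup>2)"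
  by (auto simp: Lq_def integrable_iff_bounded)

lemma Lq_1_iff: "f \<in> Lq 1 \<longleftrightarrow> integrable lebesgue f"
  by (auto simp: Lq_def integrable_iff_bounded)

lemma Lq_2_add:
  assumes "f \<in> Lq 2" "g \<in> Lq 2" shows "(\<lambda>x. f x + g x) \<in> Lq 2"
proof -
  have [measurable]: "f \<in> borel_measurable lebesgue" "g \<in> borel_measurable lebesgue"
    using assms by (auto simp: Lq_2_iff)
  have "integrable lebesgue (\<lambda>x. (f x + g x)\<^sup>2)"
  proof (rule Bochner_Integration.integrable_bound)
    show "integrable lebesgue (\<lambda>x. 2 * (f x)\<^sup>2 + 2 * (g x)\<^sup>2)" using assms by (auto simp: Lq_2_iff)
    show "AE x in lebesgue. norm ((f x + g x)\<^sup>2) \<le> norm (2 * (f x)\<^sup>2 + 2 * (g x)\<^sup>2)"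
    proof (intro AE_I2)
      fix x
      show "norm ((f x + g x)\<^sup>2) \<le> norm (2 * (f x)\<^sup>2 + 2 * (g x)\<^sup>2)"
        using zero_le_power2[of "f x - g x"] unfolding real_norm_def abs_of_nonneg[OF zero_le_power2]
        by (intro order_trans[OF _ abs_ge_self]) (simp add: power2_eq_square algebra_simps)
    qed
  qed simp
  then show ?thesis by (simp add: Lq_2_iff)
qed

lemma Lq_2_cmult: "f \<in> Lq 2 \<Longrightarrow> (\<lambda>x. c * f x) \<in> Lq 2"
  by (auto simp: Lq_2_iff power_mult_distrib)

lemma Lq_2_diff: "f \<in> Lq 2 \<Longrightarrow> g \<in> Lq 2 \<Longrightarrow> (\<lambda>x. f x - g x) \<in> Lq 2"
  using Lq_2_add[of f "\<lambda>x. -1 * g x"] Lq_2_cmult[of g "-1"] by simp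

lemma Lq_2_dominated:
  assumes "f \<in> Lq 2" "g \<in> borel_measurable lebesgue" "\<And>x. \<bar>g x\<bar> \<le> C * \<bar>f x\<bar>"
  shows "g \<in> Lq 2"
proof -
  have "integrable lebesgue (\<lambda>x. (g x)\<^sup>2)"
  proof (rule Bochner_Integration.integrable_bound)
    show "integrable lebesgue (\<lambda>x. C\<^sup>2 * (f x)\<^sup>2)" using assms by (auto simp: Lq_2_iff)
    show "AE x in lebesgue. norm ((g x)\<^sup>2) \<le> norm (C\<^sup>2 * (f x)\<^sup>2)"
    proof (intro AE_I2)
      fix x
      have "\<bar>g x\<bar> \<le> \<bar>C * f x\<bar>" using assms(3)[of x]
        by (simp add: abs_mult) (meson abs_ge_self abs_ge_zero mult_right_mono order_trans)
      then show "norm ((g x)\<^sup>2) \<le> norm (C\<^sup>2 * (f x)\<^sup>2)"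
        by (simp add: abs_le_square_iff flip: power_mult_distrib)
    qed
  qed (use assms in measurable)
  then show ?thesis using assms by (simp add: Lq_2_iff)
qed

lemma integrable_mult_Lq_2:
  assumes "f \<in> Lq 2" "g \<in> Lq 2" shows "integrable lebesgue (\<lambda>x. f x * g x)"
proof (rule Bochner_Integration.integrable_bound)
  show "integrable lebesgue (\<lambda>x. (f x)\<^sup>2 + (g x)\<^sup>2)" using assms by (auto simp: Lq_2_iff)
  show "AE x in lebesgue. norm (f x * g x) \<le> norm ((f x)\<^sup>2 + (g x)\<^sup>2)"
  proof (intro AE_I2)
    fix x
    have "2 * (\<bar>f x\<bar> * \<bar>g x\<bar>) \<le> (f x)\<^sup>2 + (g x)\<^sup>2" using sum_squares_bound[of "\<bar>f x\<bar>" "\<bar>g x\<bar>"] by simp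
    then show "norm (f x * g x) \<le> norm ((f x)\<^sup>2 + (g x)\<^sup>2)"
      using mult_nonneg_nonneg[OF abs_ge_zero abs_ge_zero, of "f x" "g x"]
      unfolding real_norm_def abs_mult by linarith
  qed
qed (use assms in \<open>auto simp: Lq_2_iff\<close>)

lemma Cauchy_Schwarz_Lq_2:
  assumes f: "f \<in> Lq 2" and g: "g \<in> Lq 2"
  shows "\<bar>\<integral>x. f x * g x \<partial>lebesgue\<bar> \<le> sqrt (\<integral>x. (f x)\<^sup>2 \<partial>lebesgue) * sqrt (\<integral>x. (g x)\<^sup>2 \<partial>lebesgue)"
proof -
  let ?A = "\<integral>x. (f x)\<^sup>2 \<partial>lebesgue" and ?B = "\<integral>x. f x * g x \<partial>lebesgue" and ?C = "\<integral>x. (g x)\<^sup>2 \<partial>lebesgue"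
  note int = integrable_mult_Lq_2[OF f g] f[unfolded Lq_2_iff] g[unfolded Lq_2_iff]
  have quad: "0 \<le> ?A + 2 * l * ?B + l\<^sup>2 * ?C" for l :: real
  proof -
    have "0 \<le> (\<integral>x. (f x + l * g x)\<^sup>2 \<partial>lebesgue)" by simp
    also have "(\<lambda>x. (f x + l * g x)\<^sup>2) = (\<lambda>x. (f x)\<^sup>2 + 2 * l * (f x * g x) + l\<^sup>2 * (g x)\<^sup>2)"
      by (auto simp: power2_eq_square algebra_simps)
    also have "(\<integral>x. (f x)\<^sup>2 + 2 * l * (f x * g x) + l\<^sup>2 * (g x)\<^sup>2 \<partial>lebesgue) = ?A + 2 * l * ?B + l\<^sup>2 * ?C"
      using int by simp
    finally show ?thesis .
  qed
  have nn: "0 \<le> ?A" "0 \<le> ?C" by auto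
  have "?B\<^sup>2 \<le> ?A * ?C"
  proof (cases "?C = 0")
    case True
    have "?B = 0"
    proof (rule ccontr)
      assume "?B \<noteq> 0"
      \<comment> \<open>With \<open>?C = 0\<close> the quadratic is affine in \<open>l\<close>, and
        this \<open>l\<close> gives it the value -1.\<close>
      then show False using quad[of "- (?A + 1) / (2 * ?B)"] True nn by (simp add: field_simps)
    qed
    then show ?thesis using True by simp
  next
    case False
    then have "?C > 0" using nn by linarith
    then have "?C * 0 \<le> ?C * (?A + 2 * (- ?B / ?C) * ?B + (- ?B / ?C)\<^sup>2 * ?C)"
      using quad[of "- ?B / ?C"] by (intro mult_left_mono) auto
    also have "\<dots> = ?A * ?C - ?B\<^sup>2" using \<open>?C > 0\<close> by (simp add: field_simps power2_eq_square)
    finally show ?thesis by simp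
  qed
  then have "sqrt (?B\<^sup>2) \<le> sqrt (?A * ?C)" by (rule real_sqrt_le_mono)
  then show ?thesis by (simp add: real_sqrt_mult)
qed

lemma Lq_dist_2_eq:
  assumes "f \<in> Lq 2" "g \<in> Lq 2"
  shows "Lq_dist 2 f g = ennreal (\<integral>x. (f x - g x)\<^sup>2 \<partial>lebesgue)"
  using Lq_2_diff[OF assms] by (simp add: Lq_dist_def Lq_2_iff nn_integral_eq_integral)

lemma Lq_dist_1_eq:
  assumes "f \<in> Lq 1" "g \<in> Lq 1"
  shows "Lq_dist 1 f g = ennreal (\<integral>x. \<bar>f x - g x\<bar> \<partial>lebesgue)"
  using assms by (simp add: Lq_dist_def Lq_1_iff nn_integral_eq_integral)

lemma tendsto_ennreal_0_iff:
  assumes "\<forall>\<^sub>F x in F. f x \<ge> 0"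
  shows "((\<lambda>x. ennreal (f x)) \<longlongrightarrow> 0) F \<longleftrightarrow> (f \<longlongrightarrow> 0) F"
proof
  assume "((\<lambda>x. ennreal (f x)) \<longlongrightarrow> 0) F"
  then have "((\<lambda>x. enn2real (ennreal (f x))) \<longlongrightarrow> enn2real (ennreal 0)) F"
    by (intro tendsto_enn2real) auto
  then show "(f \<longlongrightarrow> 0) F"
    by (rule Lim_transform_eventually[where f="\<lambda>x. enn2real (ennreal (f x))", THEN tendsto_eq_rhs]) (use assms in \<open>auto elim!: eventually_mono\<close>)
next
  assume "(f \<longlongrightarrow> 0) F"
  then show "((\<lambda>x. ennreal (f x)) \<longlongrightarrow> 0) F" using tendsto_ennrealI by force
qed

text \<open>A functional on $L^2$ with an $L^2$ gradient \<open>\<psi>\<close> and a quadratic Taylor remainder is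
  differentiable along every curve that is differentiable in $L^2$.\<close>

context
  fixes F :: "('a::euclidean_space \<Rightarrow> real) \<Rightarrow> real" and \<psi> :: "('a \<Rightarrow> real) \<Rightarrow> 'a \<Rightarrow> real" and L :: real
  assumes grad: "\<And>f. f \<in> Lq 2 \<Longrightarrow> \<psi> f \<in> Lq 2"
    and taylor: "\<And>f g. f \<in> Lq 2 \<Longrightarrow> g \<in> Lq 2 \<Longrightarrow>
      \<bar>F g - F f - (\<integral>x. \<psi> f x * (g x - f x) \<partial>lebesgue)\<bar> \<le> L * (\<integral>x. (g x - f x)\<^sup>2 \<partial>lebesgue)"
begin

lemma taylor_functional_increment:
  assumes f: "f \<in> Lq 2" and g: "g \<in> Lq 2"
  shows "\<bar>F g - F f\<bar> \<le> sqrt (\<integral>x. (\<psi> f x)\<^sup>2 \<partial>lebesgue) * sqrt (\<integral>x. (g x - f x)\<^sup>2 \<partial>lebesgue)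
      + L * (\<integral>x. (g x - f x)\<^sup>2 \<partial>lebesgue)"
  using taylor[OF f g] Cauchy_Schwarz_Lq_2[OF grad[OF f] Lq_2_diff[OF g f]] by linarith

lemma taylor_functional_continuous:
  assumes u: "\<And>t. t \<in> S \<Longrightarrow> u t \<in> Lq 2"
    and cont: "\<And>t. t \<in> S \<Longrightarrow> ((\<lambda>r. Lq_dist 2 (u r) (u t)) \<longlongrightarrow> 0) (at t within S)"
  shows "continuous_on S (\<lambda>t::real. F (u t))"
  unfolding continuous_on_def
proof
  fix t assume t: "t \<in> S"
  let ?d = "\<lambda>r. \<integral>x. (u r x - u t x)\<^sup>2 \<partial>lebesgue"
  have inS: "\<forall>\<^sub>F r in at t within S. r \<in> S" by (simp add: eventually_at_filter)
  have "((\<lambda>r. ennreal (?d r)) \<longlongrightarrow> 0) (at t within S)"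
    by (rule Lim_transform_eventually[OF cont[OF t]])
       (use inS in eventually_elim, simp add: Lq_dist_2_eq u t)
  then have d: "(?d \<longlongrightarrow> 0) (at t within S)" by (subst (asm) tendsto_ennreal_0_iff) auto
  have "((\<lambda>r. F (u r) - F (u t)) \<longlongrightarrow> 0) (at t within S)"
  proof (rule Lim_null_comparison)
    show "\<forall>\<^sub>F r in at t within S. norm (F (u r) - F (u t)) \<le> sqrt (\<integral>x. (\<psi> (u t) x)\<^sup>2 \<partial>lebesgue) * sqrt (?d r) + L * ?d r"
      using inS by eventually_elim (use taylor_functional_increment[OF u[OF t] u] in auto)
    show "((\<lambda>r. sqrt (\<integral>x. (\<psi> (u t) x)\<^sup>2 \<partial>lebesgue) * sqrt (?d r) + L * ?d r) \<longlongrightarrow> 0) (at t within S)"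
      by (rule tendsto_eq_intros d refl | simp)+
  qed
  then show "((\<lambda>t. F (u t)) \<longlongrightarrow> F (u t)) (at t within S)" by (simp add: LIM_zero_iff)
qed

text \<open>\<open>B\<close> depends on \<open>x\<close> through the norm of the gradient at
  \<open>u x\<close>; a bound centred at each single point is all that
  \<open>AE_deriv_nonpos_imp_le\<close> asks for.\<close>

lemma taylor_functional_pointwise_Lipschitz:
  fixes x :: real
  assumes u: "\<And>t. t \<ge> 0 \<Longrightarrow> u t \<in> Lq 2" and "x > 0" and L: "L \<ge> 0"
    and lip: "\<forall>\<delta>>0. \<exists>L. \<forall>r\<ge>\<delta>. \<forall>t\<ge>\<delta>. Lq_dist 2 (u r) (u t) \<le> ennreal ((L * \<bar>r - t\<bar>)\<^sup>2)"
  shows "\<exists>T B. open T \<and> x \<in> T \<and> (\<forall>y\<in>T. \<bar>F (u y) - F (u x)\<bar> \<le> B * \<bar>y - x\<bar>)"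
proof -
  obtain l where l: "\<And>r t. r \<ge> x / 2 \<Longrightarrow> t \<ge> x / 2 \<Longrightarrow> Lq_dist 2 (u r) (u t) \<le> ennreal ((l * \<bar>r - t\<bar>)\<^sup>2)"
    using lip[rule_format, of "x / 2"] \<open>x > 0\<close> by auto
  \<comment> \<open>The lower end stays away from time 0, where the Lipschitz constants of the flow
    may blow up. The upper end bounds \<open>\<bar>y - x\<bar>\<close> by \<open>x + 1\<close>, so
    that the quadratic remainder becomes linear.\<close>
  let ?T = "{x / 2<..<x + 1}" and ?P = "sqrt (\<integral>z. (\<psi> (u x) z)\<^sup>2 \<partial>lebesgue)"
  have "\<bar>F (u y) - F (u x)\<bar> \<le> (?P * \<bar>l\<bar> + L * l\<^sup>2 * (x + 1)) * \<bar>y - x\<bar>" if "y \<in> ?T" for y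
  proof -
    have xy: "u x \<in> Lq 2" "u y \<in> Lq 2" using u that \<open>x > 0\<close> by auto
    let ?d = "\<integral>z. (u y z - u x z)\<^sup>2 \<partial>lebesgue"
    have d: "?d \<le> (l * \<bar>y - x\<bar>)\<^sup>2"
      using l[of y x] that \<open>x > 0\<close> xy by (simp add: Lq_dist_2_eq)
    then have "sqrt ?d \<le> \<bar>l\<bar> * \<bar>y - x\<bar>" using real_sqrt_le_mono[OF d] by (simp add: abs_mult)
    then have "?P * sqrt ?d \<le> ?P * (\<bar>l\<bar> * \<bar>y - x\<bar>)" by (intro mult_left_mono) auto
    moreover have "L * ?d \<le> L * (l\<^sup>2 * (x + 1) * \<bar>y - x\<bar>)"
    proof (intro mult_left_mono L)
      have "\<bar>y - x\<bar> * \<bar>y - x\<bar> \<le> (x + 1) * \<bar>y - x\<bar>" using that \<open>x > 0\<close> by (intro mult_right_mono) auto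
      then have "l\<^sup>2 * (\<bar>y - x\<bar> * \<bar>y - x\<bar>) \<le> l\<^sup>2 * ((x + 1) * \<bar>y - x\<bar>)" by (intro mult_left_mono) auto
      then show "?d \<le> l\<^sup>2 * (x + 1) * \<bar>y - x\<bar>" using d by (simp add: power_mult_distrib power2_eq_square mult_ac)
    qed
    ultimately show ?thesis using taylor_functional_increment[OF xy] by (simp add: algebra_simps)
  qed
  moreover have "open ?T" "x \<in> ?T" using \<open>x > 0\<close> by auto
  ultimately show ?thesis by blast
qed

text \<open>With \<open>q h\<close> the difference quotient of the curve, the error is the pairing
  of the gradient with \<open>q h - w\<close>, small by Cauchy-Schwarz, plus a Taylor remainder of
  size |h| times the squared norm of \<open>q h\<close>, which stays bounded because
  \<open>q h\<close> converges in L^2.\<close>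

lemma taylor_functional_DERIV:
  fixes t :: real
  assumes u: "\<And>t. t \<ge> 0 \<Longrightarrow> u t \<in> Lq 2" and "t > 0" and w: "w \<in> Lq 2"
    and lim: "((\<lambda>h. Lq_dist 2 (\<lambda>x. (u (t + h) x - u t x) / h) w) \<longlongrightarrow> 0) (at 0)"
  shows "((\<lambda>t. F (u t)) has_real_derivative (\<integral>x. \<psi> (u t) x * w x \<partial>lebesgue)) (at t)"
proof -
  define q where "q = (\<lambda>h x. (u (t + h) x - u t x) / h)"
  define e where "e = (\<lambda>h. \<integral>x. (q h x - w x)\<^sup>2 \<partial>lebesgue)"
  define P where "P = (\<integral>x. (\<psi> (u t) x)\<^sup>2 \<partial>lebesgue)"
  define W where "W = (\<integral>x. (w x)\<^sup>2 \<partial>lebesgue)"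
  have ut: "u t \<in> Lq 2" using u \<open>t > 0\<close> by simp
  have near: "\<forall>\<^sub>F h in at 0. h \<noteq> 0 \<and> t + h > 0"
    using \<open>t > 0\<close> by (auto simp: eventually_at dist_real_def intro!: exI[of _ t])
  have uth: "u (t + h) \<in> Lq 2" if "t + h > 0" for h using u that by simp
  have qL: "q h \<in> Lq 2" if "t + h > 0" for h
    using Lq_2_cmult[OF Lq_2_diff[OF uth[OF that] ut], of "inverse h"] by (simp add: q_def divide_inverse mult.commute)
  have "((\<lambda>h. ennreal (e h)) \<longlongrightarrow> 0) (at 0)"
    by (rule Lim_transform_eventually[OF lim], use near in eventually_elim)
       (use qL w in \<open>simp add: Lq_dist_2_eq e_def q_def\<close>)
  then have e: "(e \<longlongrightarrow> 0) (at 0)" by (subst (asm) tendsto_ennreal_0_iff) (auto simp: e_def)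
  have "((\<lambda>h. (F (u (t + h)) - F (u t)) / h - (\<integral>x. \<psi> (u t) x * w x \<partial>lebesgue)) \<longlongrightarrow> 0) (at 0)"
  proof (rule Lim_null_comparison)
    show "\<forall>\<^sub>F h in at 0. norm ((F (u (t + h)) - F (u t)) / h - (\<integral>x. \<psi> (u t) x * w x \<partial>lebesgue))
        \<le> sqrt P * sqrt (e h) + \<bar>L\<bar> * \<bar>h\<bar> * (2 * e h + 2 * W)"
      using near
    proof eventually_elim
      case (elim h)
      then have h: "h \<noteq> 0" "t + h > 0" by auto
      note q = qL[OF h(2)]
      define R where "R = F (u (t + h)) - F (u t) - (\<integral>x. \<psi> (u t) x * (u (t + h) x - u t x) \<partial>lebesgue)"
      have i1: "integrable lebesgue (\<lambda>x. \<psi> (u t) x * q h x)" "integrable lebesgue (\<lambda>x. \<psi> (u t) x * w x)"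
        by (intro integrable_mult_Lq_2 grad ut q w)+
      have hq: "u (t + h) x - u t x = h * q h x" for x using h by (simp add: q_def)
      have "(\<integral>x. \<psi> (u t) x * (u (t + h) x - u t x) \<partial>lebesgue) = h * (\<integral>x. \<psi> (u t) x * q h x \<partial>lebesgue)"
        by (simp add: hq mult.left_commute)
      then have "(F (u (t + h)) - F (u t)) / h = (\<integral>x. \<psi> (u t) x * q h x \<partial>lebesgue) + R / h"
        using h by (simp add: R_def field_simps)
      then have split: "(F (u (t + h)) - F (u t)) / h - (\<integral>x. \<psi> (u t) x * w x \<partial>lebesgue)
          = (\<integral>x. \<psi> (u t) x * (q h x - w x) \<partial>lebesgue) + R / h"
        using i1 by (simp add: right_diff_distrib)
      have "\<bar>\<integral>x. \<psi> (u t) x * (q h x - w x) \<partial>lebesgue\<bar> \<le> sqrt P * sqrt (e h)"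
        unfolding P_def e_def by (intro Cauchy_Schwarz_Lq_2 grad ut Lq_2_diff q w)
      moreover have "\<bar>R / h\<bar> \<le> \<bar>L\<bar> * \<bar>h\<bar> * (2 * e h + 2 * W)"
      proof -
        have "\<bar>R\<bar> \<le> L * (\<integral>x. (h * q h x)\<^sup>2 \<partial>lebesgue)"
          using taylor[OF ut uth[OF h(2)]] by (simp add: R_def hq)
        also have "\<dots> \<le> \<bar>L\<bar> * (\<integral>x. (h * q h x)\<^sup>2 \<partial>lebesgue)" by (intro mult_right_mono) auto
        also have "(\<integral>x. (h * q h x)\<^sup>2 \<partial>lebesgue) = h\<^sup>2 * (\<integral>x. (q h x)\<^sup>2 \<partial>lebesgue)" by (simp add: power_mult_distrib)
        also have "(\<integral>x. (q h x)\<^sup>2 \<partial>lebesgue) \<le> (\<integral>x. 2 * (q h x - w x)\<^sup>2 + 2 * (w x)\<^sup>2 \<partial>lebesgue)"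
        proof (rule integral_mono)
          show "integrable lebesgue (\<lambda>x. (q h x)\<^sup>2)" using q by (simp add: Lq_2_iff)
          show "integrable lebesgue (\<lambda>x. 2 * (q h x - w x)\<^sup>2 + 2 * (w x)\<^sup>2)"
            using Lq_2_diff[OF q w] w by (simp add: Lq_2_iff)
          show "(q h x)\<^sup>2 \<le> 2 * (q h x - w x)\<^sup>2 + 2 * (w x)\<^sup>2" for x
            using zero_le_power2[of "q h x - 2 * w x"] by (simp add: power2_eq_square algebra_simps)
        qed
        also have "\<dots> = 2 * e h + 2 * W" using Lq_2_diff[OF q w] w by (simp add: Lq_2_iff e_def W_def)
        finally have "\<bar>R\<bar> \<le> \<bar>L\<bar> * (h\<^sup>2 * (2 * e h + 2 * W))" by (simp add: mult_left_mono)
        also have "h\<^sup>2 = \<bar>h\<bar> * \<bar>h\<bar>" by (simp add: power2_eq_square)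
        also have "\<bar>L\<bar> * (\<bar>h\<bar> * \<bar>h\<bar> * (2 * e h + 2 * W)) = \<bar>h\<bar> * (\<bar>L\<bar> * \<bar>h\<bar> * (2 * e h + 2 * W))"
          by (simp only: mult_ac)
        finally show ?thesis using h by (simp add: divide_le_eq mult.commute)
      qed
      ultimately show ?case unfolding split real_norm_def by linarith
    qed
    show "((\<lambda>h. sqrt P * sqrt (e h) + \<bar>L\<bar> * \<bar>h\<bar> * (2 * e h + 2 * W)) \<longlongrightarrow> 0) (at 0)"
      by (rule tendsto_eq_intros e refl | simp)+
  qed
  then show ?thesis by (simp add: DERIV_def LIM_zero_iff)
qed

end

section \<open>The subdifferential inequality\<close>

interpretation lebesgue: sigma_finite_measure "lebesgue :: 'a::euclidean_space measure"
  by (rule sigma_finite_lebesgue)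

interpretation lebesgue_pair: pair_sigma_finite "lebesgue :: 'a::euclidean_space measure" "lebesgue :: 'a measure" ..

section \<open>Measurability on the product space and the energy as an integral\<close>

lemma borel_measurable_lebesgue_fst:
  "f \<in> borel_measurable lebesgue \<Longrightarrow> (\<lambda>z. f (fst z)) \<in> borel_measurable (lebesgue \<Otimes>\<^sub>M lebesgue)"
  by (rule measurable_compose[OF measurable_fst])

lemma borel_measurable_lebesgue_snd:
  "f \<in> borel_measurable lebesgue \<Longrightarrow> (\<lambda>z. f (snd z)) \<in> borel_measurable (lebesgue \<Otimes>\<^sub>M lebesgue)"
  by (rule measurable_compose[OF measurable_snd])

lemma borel_measurable_lebesgue_pair_diff:
  fixes f :: "'a::euclidean_space \<Rightarrow> 'b::topological_space"
  assumes "f \<in> borel_measurable borel"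
  shows "(\<lambda>z. f (fst z - snd z)) \<in> borel_measurable (lebesgue \<Otimes>\<^sub>M (lebesgue :: 'a measure))"
proof -
  have "(\<lambda>z. fst z) \<in> (lebesgue \<Otimes>\<^sub>M (lebesgue :: 'a measure)) \<rightarrow>\<^sub>M borel"
       "(\<lambda>z. snd z) \<in> ((lebesgue :: 'a measure) \<Otimes>\<^sub>M lebesgue) \<rightarrow>\<^sub>M borel"
    by (intro borel_measurable_lebesgue_fst borel_measurable_lebesgue_snd measurable_completion, simp)+
  then have "(\<lambda>z. fst z - snd z) \<in> (lebesgue \<Otimes>\<^sub>M (lebesgue :: 'a measure)) \<rightarrow>\<^sub>M borel"
    by (rule borel_measurable_diff)
  from measurable_compose[OF this assms] show ?thesis .
qed

lemma frac_energy_eq_integral: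
  fixes u :: "'a::euclidean_space \<Rightarrow> real" and s p :: real
  assumes "u \<in> borel_measurable lebesgue" "p > 0"
  defines "g \<equiv> \<lambda>z. \<bar>u (fst z) - u (snd z)\<bar> powr p / norm (fst z - snd z) powr (real DIM('a) + s * p)"
  shows "frac_energy s p u < \<infinity> \<longleftrightarrow> integrable (lebesgue \<Otimes>\<^sub>M lebesgue) g"
    and "enn2real (frac_energy s p u) = (1 / p) * (\<integral>z. g z \<partial>(lebesgue \<Otimes>\<^sub>M lebesgue))"
proof -
  note [measurable] = borel_measurable_lebesgue_fst[OF assms(1)] borel_measurable_lebesgue_snd[OF assms(1)]
  have [measurable]: "(\<lambda>z. norm (fst z - snd z) powr (real DIM('a) + s * p)) \<in> borel_measurable (lebesgue \<Otimes>\<^sub>M (lebesgue :: 'a measure))"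
    by (rule borel_measurable_lebesgue_pair_diff) simp
  have g [measurable]: "g \<in> borel_measurable (lebesgue \<Otimes>\<^sub>M lebesgue)" unfolding g_def by measurable
  have nn: "g z \<ge> 0" for z by (simp add: g_def)
  have e: "frac_energy s p u = ennreal (1 / p) * (\<integral>\<^sup>+ z. ennreal (g z) \<partial>(lebesgue \<Otimes>\<^sub>M lebesgue))"
    by (simp add: frac_energy_def g_def)
  show "frac_energy s p u < \<infinity> \<longleftrightarrow> integrable (lebesgue \<Otimes>\<^sub>M lebesgue) g"
    using \<open>p > 0\<close> g nn by (auto simp: e ennreal_mult_less_top integrable_iff_bounded)
  have "(\<integral>z. g z \<partial>(lebesgue \<Otimes>\<^sub>M lebesgue)) = enn2real (\<integral>\<^sup>+ z. ennreal (g z) \<partial>(lebesgue \<Otimes>\<^sub>M lebesgue))"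
    using nn by (intro integral_eq_nn_integral) auto
  then show "enn2real (frac_energy s p u) = (1 / p) * (\<integral>z. g z \<partial>(lebesgue \<Otimes>\<^sub>M lebesgue))"
    using \<open>p > 0\<close> by (simp add: e enn2real_mult)
qed

text \<open>The chain rule at step size 0, taken along a sequence so that dominated convergence
  applies.\<close>

lemma abs_powr_diff_quotient_tendsto:
  fixes A B p :: real
  assumes "p > 1"
  shows "(\<lambda>n. (\<bar>A - inverse (real (Suc n)) * B\<bar> powr p - \<bar>A\<bar> powr p) / (p * inverse (real (Suc n)))) \<longlonglongrightarrow> - odd_power (p - 1) A * B"
proof -
  have "((\<lambda>h. A - h * B) has_real_derivative - B) (at 0)" by (auto intro!: derivative_eq_intros)
  then have "((\<lambda>h. \<bar>A - h * B\<bar> powr p) has_real_derivative p * odd_power (p - 1) A * - B) (at 0)"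
    using DERIV_chain2[of "\<lambda>x. \<bar>x\<bar> powr p" "p * odd_power (p - 1) A" "\<lambda>h. A - h * B" 0 "- B"] DERIV_abs_powr[OF assms, of A]
    by simp
  then have d: "((\<lambda>h. (\<bar>A - h * B\<bar> powr p - \<bar>A\<bar> powr p) / h) \<longlongrightarrow> p * odd_power (p - 1) A * - B) (at 0)"
    by (simp add: DERIV_def)
  have "filterlim (\<lambda>n. inverse (real (Suc n))) (at 0) sequentially"
    using LIMSEQ_inverse_real_of_nat by (simp add: filterlim_at)
  from filterlim_compose[OF d this]
  have "(\<lambda>n. (\<bar>A - inverse (real (Suc n)) * B\<bar> powr p - \<bar>A\<bar> powr p) / inverse (real (Suc n)) / p) \<longlonglongrightarrow> p * odd_power (p - 1) A * - B / p"
    using assms by (intro tendsto_divide) auto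
  then show ?thesis using assms by (simp add: divide_divide_eq_left mult.commute)
qed

text \<open>The first variation of the energy. The competitor \<open>v - h * \<psi>\<close> with
  \<open>h > 0\<close> bounds the pairing of \<psi> and \<open>w\<close> by a difference quotient of
  the energy; as \<open>h\<close> tends to 0 this becomes the integral of
  \<open>- odd_power (p - 1) (v x - v y) * (\<psi> x - \<psi> y)\<close> against the kernel, where
  the pointwise majorant \<open>b\<close> takes over.\<close>

lemma frac_subdiff_test:
  fixes v w \<psi> :: "'a::euclidean_space \<Rightarrow> real" and b :: "'a \<times> 'a \<Rightarrow> real"
  assumes "p > 1"
    and sub: "frac_subdiff s p v (\<lambda>x. - w x)"
    and psi: "\<psi> \<in> Lq 2" "frac_energy s p \<psi> < \<infinity>"
    and le: "\<And>x y. - odd_power (p - 1) (v x - v y) * (\<psi> x - \<psi> y) \<le> b (x, y)"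
    and b: "(\<lambda>z. b z / norm (fst z - snd z) powr (real DIM('a) + s * p)) \<in> borel_measurable (lebesgue \<Otimes>\<^sub>M lebesgue)"
      "(\<integral>\<^sup>+ z. ennreal (b z / norm (fst z - snd z) powr (real DIM('a) + s * p)) \<partial>(lebesgue \<Otimes>\<^sub>M lebesgue)) \<le> ennreal K"
      "\<And>z. b z \<ge> 0" "K \<ge> 0"
  shows "(\<integral>x. \<psi> x * w x \<partial>lebesgue) \<le> K"
proof -
  define M where "M = (lebesgue :: 'a measure) \<Otimes>\<^sub>M (lebesgue :: 'a measure)"
  define k where "k = (\<lambda>z::'a \<times> 'a. norm (fst z - snd z) powr (real DIM('a) + s * p))"
  define A where "A = (\<lambda>z. v (fst z) - v (snd z))"
  define B where "B = (\<lambda>z. \<psi> (fst z) - \<psi> (snd z))"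
  define h where "h = (\<lambda>n. inverse (real (Suc n)))"
  define q where "q = (\<lambda>n z. (\<bar>A z - h n * B z\<bar> powr p - \<bar>A z\<bar> powr p) / (p * h n) / k z)"
  have h: "0 < h n" "h n \<le> 1" for n by (auto simp: h_def field_simps)
  have v: "v \<in> Lq 2" "frac_energy s p v < \<infinity>" and w': "(\<lambda>x. - w x) \<in> Lq 2" using sub by (auto simp: frac_subdiff_def)
  have w: "w \<in> Lq 2" using Lq_2_cmult[OF w', of "-1"] by simp
  have m: "v \<in> borel_measurable lebesgue" "\<psi> \<in> borel_measurable lebesgue"
    using v psi by (auto simp: Lq_2_iff)
  have k [measurable]: "k \<in> borel_measurable M" unfolding k_def M_def
    by (rule borel_measurable_lebesgue_pair_diff) simp
  have [measurable]: "A \<in> borel_measurable M" "B \<in> borel_measurable M" unfolding A_def B_def M_def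
    by (intro borel_measurable_diff borel_measurable_lebesgue_fst borel_measurable_lebesgue_snd m)+
  have k0: "k z \<ge> 0" for z by (simp add: k_def)
  have iA: "integrable M (\<lambda>z. \<bar>A z\<bar> powr p / k z)" and iB: "integrable M (\<lambda>z. \<bar>B z\<bar> powr p / k z)"
    using frac_energy_eq_integral(1)[of v p s] frac_energy_eq_integral(1)[of \<psi> p s] v psi m \<open>p > 1\<close>
    by (auto simp: M_def A_def B_def k_def)
  have dom: "\<bar>q n z\<bar> \<le> 2 powr p * (\<bar>A z\<bar> powr p / k z + \<bar>B z\<bar> powr p / k z)" for n z
  proof -
    have "\<bar>q n z\<bar> = \<bar>(\<bar>A z - h n * B z\<bar> powr p - \<bar>A z\<bar> powr p) / (p * h n)\<bar> / k z"
      unfolding q_def abs_divide[of _ "k z"] using k0[of z] by simp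
    also have "\<dots> \<le> 2 powr p * (\<bar>A z\<bar> powr p + \<bar>B z\<bar> powr p) / k z"
      using h[of n] \<open>p > 1\<close> by (intro divide_right_mono abs_powr_diff_quotient_bound k0) auto
    finally show ?thesis by (simp add: add_divide_distrib distrib_left)
  qed
  have iD: "integrable M (\<lambda>z. 2 powr p * (\<bar>A z\<bar> powr p / k z + \<bar>B z\<bar> powr p / k z))"
    using iA iB by simp
  have qm [measurable]: "q n \<in> borel_measurable M" for n unfolding q_def by measurable
  have iq: "integrable M (q n)" for n
    by (rule Bochner_Integration.integrable_bound[OF iD]) (use dom in \<open>auto intro!: AE_I2 order_trans[OF _ abs_ge_self]\<close>)
  have test: "(\<integral>x. \<psi> x * w x \<partial>lebesgue) \<le> (\<integral>z. q n z \<partial>M)" for n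
  proof -
    \<comment> \<open>Here \<open>y - v = - h n * \<psi>\<close>, and the subgradient is
      \<open>- w\<close>, so the two signs cancel in the pairing and division by
      \<open>h n > 0\<close> keeps the inequality.\<close>
    define y where "y = (\<lambda>x. v x - h n * \<psi> x)"
    have yL: "y \<in> Lq 2" unfolding y_def by (intro Lq_2_diff Lq_2_cmult v psi)
    then have ym: "y \<in> borel_measurable lebesgue" by (simp add: Lq_2_iff)
    have dy: "y (fst z) - y (snd z) = A z - h n * B z" for z by (simp add: y_def A_def B_def algebra_simps)
    have yq: "\<bar>A z - h n * B z\<bar> powr p / k z = p * h n * q n z + \<bar>A z\<bar> powr p / k z" for z
    proof -
      have "p * h n * q n z = (\<bar>A z - h n * B z\<bar> powr p - \<bar>A z\<bar> powr p) / k z"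
        using h(1)[of n] \<open>p > 1\<close> by (simp add: q_def)
      then show ?thesis by (simp add: diff_divide_distrib)
    qed
    have iy: "integrable M (\<lambda>z. \<bar>A z - h n * B z\<bar> powr p / k z)" unfolding yq using iq iA by simp
    have fin: "frac_energy s p y < \<infinity>"
      using frac_energy_eq_integral(1)[OF ym, of p s] iy \<open>p > 1\<close> by (simp add: dy M_def k_def)
    have "enn2real (frac_energy s p v) + (\<integral>x. - w x * (y x - v x) \<partial>lebesgue) \<le> enn2real (frac_energy s p y)"
      using sub yL fin by (auto simp: frac_subdiff_def)
    also have "enn2real (frac_energy s p v) = (1 / p) * (\<integral>z. \<bar>A z\<bar> powr p / k z \<partial>M)"
      using frac_energy_eq_integral(2)[OF m(1), of p s] \<open>p > 1\<close> by (simp add: A_def k_def M_def)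
    also have "enn2real (frac_energy s p y) = (1 / p) * (\<integral>z. \<bar>A z - h n * B z\<bar> powr p / k z \<partial>M)"
      using frac_energy_eq_integral(2)[OF ym, of p s] \<open>p > 1\<close> by (simp add: dy k_def M_def)
    also have "\<dots> = h n * (\<integral>z. q n z \<partial>M) + (1 / p) * (\<integral>z. \<bar>A z\<bar> powr p / k z \<partial>M)"
      unfolding yq using iq iA \<open>p > 1\<close> by (simp add: distrib_left)
    also have "(\<integral>x. - w x * (y x - v x) \<partial>lebesgue) = h n * (\<integral>x. \<psi> x * w x \<partial>lebesgue)"
    proof -
      have "(\<lambda>x. - w x * (y x - v x)) = (\<lambda>x. h n * (\<psi> x * w x))" by (auto simp: y_def)
      then show ?thesis by simp
    qed
    finally have "h n * (\<integral>x. \<psi> x * w x \<partial>lebesgue) \<le> h n * (\<integral>z. q n z \<partial>M)" by simp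
    then show ?thesis using h[of n] by simp
  qed
  have om: "(\<lambda>z. - odd_power (p - 1) (A z) * B z / k z) \<in> borel_measurable M"
    unfolding odd_power_def by measurable
  have pw: "AE z in M. (\<lambda>n. q n z) \<longlonglongrightarrow> - odd_power (p - 1) (A z) * B z / k z"
  proof (intro AE_I2)
    fix z
    show "(\<lambda>n. q n z) \<longlonglongrightarrow> - odd_power (p - 1) (A z) * B z / k z"
    \<comment> \<open>\<open>k\<close> vanishes exactly on the diagonal, where division by zero
      makes both the quotients and their limit 0.\<close>
    proof (cases "k z = 0")
      case False
      then show ?thesis unfolding q_def h_def
        by (intro tendsto_divide abs_powr_diff_quotient_tendsto \<open>p > 1\<close>) auto
    qed (simp add: q_def)
  qed
  have bd: "AE z in M. norm (q n z) \<le> 2 powr p * (\<bar>A z\<bar> powr p / k z + \<bar>B z\<bar> powr p / k z)" for n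
    using dom by simp
  note dc = integral_dominated_convergence[OF om qm iD pw bd] integrable_dominated_convergence[OF om qm iD pw bd]
  have ib: "integrable M (\<lambda>z. b z / k z)"
  proof (rule integrableI_nonneg)
    show "(\<lambda>z. b z / k z) \<in> borel_measurable M" using b(1) by (simp add: M_def k_def)
    show "AE z in M. 0 \<le> b z / k z" using b(3) k0 by auto
    show "(\<integral>\<^sup>+ z. ennreal (b z / k z) \<partial>M) < \<infinity>"
      unfolding M_def k_def by (rule order_le_less_trans[OF b(2)]) simp
  qed
  have "(\<integral>z. - odd_power (p - 1) (A z) * B z / k z \<partial>M) \<le> (\<integral>z. b z / k z \<partial>M)"
  proof (rule Bochner_Integration.integral_mono)
    show "integrable M (\<lambda>z. - odd_power (p - 1) (A z) * B z / k z)"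
      by (rule dc)
    show "- odd_power (p - 1) (A z) * B z / k z \<le> b z / k z" for z
      using le[of "fst z" "snd z"] k0[of z] by (intro divide_right_mono) (auto simp: A_def B_def)
  qed (rule ib)
  also have "\<dots> \<le> K"
  proof -
    have "ennreal (\<integral>z. b z / k z \<partial>M) = (\<integral>\<^sup>+ z. ennreal (b z / k z) \<partial>M)"
      using ib b(3) k0 by (intro nn_integral_eq_integral[symmetric]) auto
    also have "\<dots> \<le> ennreal K" using b(2) by (simp add: M_def k_def)
    finally show ?thesis using b(4) by simp
  qed
  finally have "(\<integral>z. - odd_power (p - 1) (A z) * B z / k z \<partial>M) \<le> K" .
  with LIMSEQ_le_const[OF dc(1), of "\<integral>x. \<psi> x * w x \<partial>lebesgue"] test show ?thesis by fastforce
qed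

section \<open>Cutoff functions\<close>

definition cutoff :: "real \<Rightarrow> 'a::euclidean_space \<Rightarrow> real" where
  "cutoff R x = max 0 (1 - norm x / R)"

text \<open>Translation-invariant majorant of the p-th power of a cutoff difference over the
  singular kernel, obtained from \<open>cutoff_diff\<close>. Depending on \<open>x - y\<close> only,
  it decouples from the weight under Tonelli.\<close>

definition cutoff_kernel :: "real \<Rightarrow> real \<Rightarrow> real \<Rightarrow> 'a::euclidean_space \<Rightarrow> real" where
  "cutoff_kernel s p R z = min 1 (norm z / R) powr p / norm z powr (real DIM('a) + s * p)"

text \<open>The type argument fixes the space, which the extended real value does not reveal. By
  scaling, for \<open>R > 0\<close> this is R^(-sp) times its value at \<open>R = 1\<close>; only
  the convergence to 0 is used.\<close>

definition cutoff_mass :: "'a::euclidean_space itself \<Rightarrow> real \<Rightarrow> real \<Rightarrow> real \<Rightarrow> ennreal" where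
  "cutoff_mass _ s p R = (\<integral>\<^sup>+ z. ennreal (cutoff_kernel s p R (z::'a)) \<partial>lborel)"

lemma cutoff_kernel_nonneg: "cutoff_kernel s p R z \<ge> 0"
  by (simp add: cutoff_kernel_def)

lemma cutoff_kernel_measurable [measurable]: "cutoff_kernel s p R \<in> borel_measurable borel"
  unfolding cutoff_kernel_def[abs_def] by measurable

lemma cutoff_measurable: "cutoff R \<in> borel_measurable lebesgue"
  unfolding cutoff_def[abs_def] by (rule measurable_completion) measurable

lemma cutoff_bounds: "R > 0 \<Longrightarrow> 0 \<le> cutoff R x" "R > 0 \<Longrightarrow> cutoff R x \<le> 1"
  by (auto simp: cutoff_def)

lemma cutoff_eq_0: "R > 0 \<Longrightarrow> norm x \<ge> R \<Longrightarrow> cutoff R x = 0"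
  by (auto simp: cutoff_def max_def field_simps)

lemma cutoff_tendsto: "(\<lambda>n. cutoff (real (Suc n)) x) \<longlonglongrightarrow> 1"
proof -
  have "(\<lambda>n. max 0 (1 - norm x * inverse (real (Suc n)))) \<longlonglongrightarrow> max 0 (1 - norm x * 0)"
    by (intro tendsto_max tendsto_diff tendsto_mult tendsto_const LIMSEQ_inverse_real_of_nat)
  then show ?thesis by (simp add: cutoff_def divide_inverse)
qed

lemma cutoff_diff:
  assumes "R > 0" shows "\<bar>cutoff R x - cutoff R y\<bar> \<le> min 1 (norm (x - y) / R)"
proof -
  have "\<bar>norm x / R - norm y / R\<bar> \<le> norm (x - y) / R"
    using assms norm_triangle_ineq3[of x y] by (simp add: divide_right_mono flip: diff_divide_distrib)
  moreover have "\<bar>cutoff R x - cutoff R y\<bar> \<le> \<bar>norm x / R - norm y / R\<bar>" by (auto simp: cutoff_def)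
  moreover have "\<bar>cutoff R x - cutoff R y\<bar> \<le> 1"
    using cutoff_bounds[OF assms, of x] cutoff_bounds[OF assms, of y] by linarith
  ultimately show ?thesis by simp
qed

lemma cutoff_diff_powr_le_kernel:
  fixes x y :: "'a::euclidean_space"
  assumes "R > 0" "p > 0"
  shows "\<bar>cutoff R x - cutoff R y\<bar> powr p / norm (x - y) powr (real DIM('a) + s * p) \<le> cutoff_kernel s p R (x - y)"
  unfolding cutoff_kernel_def using assms
  by (intro divide_right_mono powr_mono2 cutoff_diff) auto

lemma cutoff_Lq_2: "R > 0 \<Longrightarrow> (cutoff R :: 'a::euclidean_space \<Rightarrow> real) \<in> Lq 2"
proof -
  assume R: "R > 0"
  have "integrable lebesgue (\<lambda>x::'a. (cutoff R x)\<^sup>2)"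
  proof (rule Bochner_Integration.integrable_bound)
    show "integrable lebesgue (indicator (ball 0 R) :: 'a \<Rightarrow> real)"
      using emeasure_lborel_ball_finite[of "0::'a" R] by (auto simp: integrable_indicator_iff)
    show "(\<lambda>x::'a. (cutoff R x)\<^sup>2) \<in> borel_measurable lebesgue" using cutoff_measurable by measurable
    show "AE x::'a in lebesgue. norm ((cutoff R x)\<^sup>2) \<le> norm (indicator (ball 0 R) x :: real)"
    proof (intro AE_I2)
      fix x :: 'a
      show "norm ((cutoff R x)\<^sup>2) \<le> norm (indicator (ball 0 R) x :: real)"
        using cutoff_bounds[OF R, of x] cutoff_eq_0[OF R, of x] power_le_one[of "cutoff R x" 2]
        by (cases "norm x < R") auto
    qed
  qed
  then show ?thesis using cutoff_measurable by (simp add: Lq_2_iff)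
qed

section \<open>Convolution estimates for the cutoff terms\<close>

lemma nn_integral_convolution_reflect:
  fixes H :: "'a::euclidean_space \<Rightarrow> ennreal"
  assumes [measurable]: "H \<in> borel_measurable borel"
  shows "(\<integral>\<^sup>+ y. H (x - y) \<partial>lebesgue) = (\<integral>\<^sup>+ z. H z \<partial>lborel)"
    and "(\<integral>\<^sup>+ y. H (y - x) \<partial>lebesgue) = (\<integral>\<^sup>+ z. H z \<partial>lborel)"
proof -
  have 1: "lborel = distr lborel borel (\<lambda>y::'a. x - y)"
    using lborel_affine[of "-1" x] by (simp add: density_1 cong: distr_cong)
  have 2: "lborel = distr lborel borel (\<lambda>y::'a. y - x)"
    using lborel_affine[of 1 "- x"] by (simp add: density_1 cong: distr_cong)
  show "(\<integral>\<^sup>+ y. H (x - y) \<partial>lebesgue) = (\<integral>\<^sup>+ z. H z \<partial>lborel)"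
    by (subst (2) 1) (simp add: nn_integral_completion nn_integral_distr)
  show "(\<integral>\<^sup>+ y. H (y - x) \<partial>lebesgue) = (\<integral>\<^sup>+ z. H z \<partial>lborel)"
    by (subst (2) 2) (simp add: nn_integral_completion nn_integral_distr)
qed

text \<open>Tonelli with the variable of \<open>g\<close> outermost; translation and reflection
  invariance then make the inner integral a constant.\<close>

lemma nn_integral_pair_convolution:
  fixes H :: "'a::euclidean_space \<Rightarrow> ennreal"
  assumes H: "H \<in> borel_measurable borel" and g: "g \<in> borel_measurable lebesgue"
  shows "(\<integral>\<^sup>+ z. g (fst z) * H (fst z - snd z) \<partial>(lebesgue \<Otimes>\<^sub>M lebesgue)) = (\<integral>\<^sup>+ x. g x \<partial>lebesgue) * (\<integral>\<^sup>+ z. H z \<partial>lborel)"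
    and "(\<integral>\<^sup>+ z. g (snd z) * H (fst z - snd z) \<partial>(lebesgue \<Otimes>\<^sub>M lebesgue)) = (\<integral>\<^sup>+ x. g x \<partial>lebesgue) * (\<integral>\<^sup>+ z. H z \<partial>lborel)"
proof -
  note m = borel_measurable_lebesgue_fst[OF g] borel_measurable_lebesgue_snd[OF g] borel_measurable_lebesgue_pair_diff[OF H]
  have m1: "(\<lambda>y. H (x - y)) \<in> borel_measurable lebesgue" "(\<lambda>y. H (y - x)) \<in> borel_measurable lebesgue" for x
    using H by (auto intro!: measurable_completion)
  have "(\<integral>\<^sup>+ z. g (fst z) * H (fst z - snd z) \<partial>(lebesgue \<Otimes>\<^sub>M lebesgue))
      = (\<integral>\<^sup>+ x. (\<integral>\<^sup>+ y. g x * H (x - y) \<partial>lebesgue) \<partial>lebesgue)"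
    using lebesgue.nn_integral_fst[OF borel_measurable_times_ennreal[OF m(1,3)]] by simp
  also have "\<dots> = (\<integral>\<^sup>+ x. g x * (\<integral>\<^sup>+ z. H z \<partial>lborel) \<partial>lebesgue)"
    using m1 by (simp add: nn_integral_cmult nn_integral_convolution_reflect[OF H])
  also have "\<dots> = (\<integral>\<^sup>+ x. g x \<partial>lebesgue) * (\<integral>\<^sup>+ z. H z \<partial>lborel)"
    using g by (simp add: nn_integral_multc)
  finally show "(\<integral>\<^sup>+ z. g (fst z) * H (fst z - snd z) \<partial>(lebesgue \<Otimes>\<^sub>M lebesgue)) = (\<integral>\<^sup>+ x. g x \<partial>lebesgue) * (\<integral>\<^sup>+ z. H z \<partial>lborel)" .
  have "(\<integral>\<^sup>+ z. g (snd z) * H (fst z - snd z) \<partial>(lebesgue \<Otimes>\<^sub>M lebesgue))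
      = (\<integral>\<^sup>+ y. (\<integral>\<^sup>+ x. g y * H (x - y) \<partial>lebesgue) \<partial>lebesgue)"
    using lebesgue_pair.nn_integral_snd[OF borel_measurable_times_ennreal[OF m(2,3)]] by simp
  also have "\<dots> = (\<integral>\<^sup>+ x. g x * (\<integral>\<^sup>+ z. H z \<partial>lborel) \<partial>lebesgue)"
    using m1 by (simp add: nn_integral_cmult nn_integral_convolution_reflect[OF H])
  also have "\<dots> = (\<integral>\<^sup>+ x. g x \<partial>lebesgue) * (\<integral>\<^sup>+ z. H z \<partial>lborel)"
    using g by (simp add: nn_integral_multc)
  finally show "(\<integral>\<^sup>+ z. g (snd z) * H (fst z - snd z) \<partial>(lebesgue \<Otimes>\<^sub>M lebesgue)) = (\<integral>\<^sup>+ x. g x \<partial>lebesgue) * (\<integral>\<^sup>+ z. H z \<partial>lborel)" .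
qed

lemma cutoff_kernel_mono:
  assumes "R \<ge> 1" "p > 0"
  shows "cutoff_kernel s p R z \<le> cutoff_kernel s p 1 z"
proof -
  have "norm z / R \<le> norm z / 1" using assms by (intro divide_left_mono) auto
  then show ?thesis unfolding cutoff_kernel_def using assms
    by (intro divide_right_mono powr_mono2) auto
qed

lemma cutoff_mass_finite:
  assumes "0 < s" "s < 1" "p > 0" "R \<ge> 1"
  shows "cutoff_mass TYPE('a::euclidean_space) s p R < \<infinity>"
proof -
  have "cutoff_mass TYPE('a) s p R \<le> cutoff_mass TYPE('a) s p 1"
    unfolding cutoff_mass_def using assms by (intro nn_integral_mono ennreal_leI cutoff_kernel_mono)
  also have "\<dots> < \<infinity>"
    using cutoff_kernel_integrable[where 'a='a, OF assms(1-3)] by (simp add: cutoff_mass_def cutoff_kernel_def)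
  finally show ?thesis .
qed

text \<open>The kernel for \<open>R = 1\<close> dominates all later ones, and each fixed
  \<open>z\<close> has \<open>norm z / R\<close> tending to 0. This is the factor by which the
  remainder of the absorbed flux vanishes.\<close>

lemma cutoff_mass_tendsto:
  assumes "0 < s" "s < 1" "p > 0"
  shows "(\<lambda>n. cutoff_mass TYPE('a::euclidean_space) s p (real (Suc n))) \<longlonglongrightarrow> 0"
proof -
  have "(\<lambda>n. \<integral>\<^sup>+ z. ennreal (cutoff_kernel s p (real (Suc n)) (z::'a)) \<partial>lborel) \<longlonglongrightarrow> (\<integral>\<^sup>+ z. 0 \<partial>(lborel :: 'a measure))"
  proof (rule nn_integral_dominated_convergence[where w = "\<lambda>z. ennreal (cutoff_kernel s p 1 z)"])
    show "(\<integral>\<^sup>+ z. ennreal (cutoff_kernel s p 1 (z::'a)) \<partial>lborel) < \<infinity>"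
      using cutoff_mass_finite[OF assms, where 'a='a and R=1] by (simp add: cutoff_mass_def)
    show "AE z in lborel. ennreal (cutoff_kernel s p (real (Suc n)) (z::'a)) \<le> ennreal (cutoff_kernel s p 1 z)" for n
      using assms by (intro AE_I2 ennreal_leI cutoff_kernel_mono) auto
    show "AE z in lborel. (\<lambda>n. ennreal (cutoff_kernel s p (real (Suc n)) (z::'a))) \<longlonglongrightarrow> 0"
    proof (intro AE_I2)
      fix z :: 'a
      have "(\<lambda>n. norm z * inverse (real (Suc n))) \<longlonglongrightarrow> norm z * 0"
        by (intro tendsto_mult tendsto_const LIMSEQ_inverse_real_of_nat)
      then have "(\<lambda>n. min 1 (norm z * inverse (real (Suc n)))) \<longlonglongrightarrow> min 1 (norm z * 0)"
        by (intro tendsto_min tendsto_const)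
      then have "(\<lambda>n. min 1 (norm z * inverse (real (Suc n))) powr p) \<longlonglongrightarrow> 0"
        using assms by (intro tendsto_zero_powrI[where b = p]) (auto simp del: of_nat_Suc)
      then have "(\<lambda>n. cutoff_kernel s p (real (Suc n)) z) \<longlonglongrightarrow> 0"
        unfolding cutoff_kernel_def divide_inverse by (rule tendsto_mult_left_zero)
      then show "(\<lambda>n. ennreal (cutoff_kernel s p (real (Suc n)) z)) \<longlonglongrightarrow> 0"
        by (subst tendsto_ennreal_0_iff) (auto simp: cutoff_kernel_nonneg)
    qed
  qed (auto intro!: measurable_compose[OF cutoff_kernel_measurable])
  then show ?thesis by (simp add: cutoff_mass_def)
qed

text \<open>After the cutoff difference is replaced by \<open>cutoff_kernel\<close>, each of the two
  summands of the weight gives one L^1 norm times the kernel mass, whence the factor 2.\<close>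

lemma nn_integral_weighted_cutoff:
  fixes v :: "'a::euclidean_space \<Rightarrow> real"
  assumes "R > 0" "p > 0" and v: "v \<in> borel_measurable lebesgue"
  shows "(\<integral>\<^sup>+ z. ennreal ((\<bar>v (fst z)\<bar> + \<bar>v (snd z)\<bar>) * \<bar>cutoff R (fst z) - cutoff R (snd z)\<bar> powr p
           / norm (fst z - snd z) powr (real DIM('a) + s * p)) \<partial>(lebesgue \<Otimes>\<^sub>M lebesgue))
       \<le> 2 * (\<integral>\<^sup>+ x. ennreal \<bar>v x\<bar> \<partial>lebesgue) * cutoff_mass TYPE('a) s p R"
proof -
  define H where "H = (\<lambda>z::'a. ennreal (cutoff_kernel s p R z))"
  define g where "g = (\<lambda>x. ennreal \<bar>v x\<bar>)"
  have H: "H \<in> borel_measurable borel" unfolding H_def by measurable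
  have g: "g \<in> borel_measurable lebesgue" using v by (simp add: g_def)
  note m = borel_measurable_lebesgue_fst[OF g] borel_measurable_lebesgue_snd[OF g] borel_measurable_lebesgue_pair_diff[OF H]
  have "ennreal ((\<bar>v x\<bar> + \<bar>v y\<bar>) * \<bar>cutoff R x - cutoff R y\<bar> powr p / norm (x - y) powr (real DIM('a) + s * p))
      \<le> g x * H (x - y) + g y * H (x - y)" for x y
  proof -
    have "(\<bar>v x\<bar> + \<bar>v y\<bar>) * (\<bar>cutoff R x - cutoff R y\<bar> powr p / norm (x - y) powr (real DIM('a) + s * p))
        \<le> (\<bar>v x\<bar> + \<bar>v y\<bar>) * cutoff_kernel s p R (x - y)"
      using cutoff_diff_powr_le_kernel[OF assms(1,2)] by (intro mult_left_mono) auto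
    then have "ennreal ((\<bar>v x\<bar> + \<bar>v y\<bar>) * \<bar>cutoff R x - cutoff R y\<bar> powr p / norm (x - y) powr (real DIM('a) + s * p))
        \<le> ennreal ((\<bar>v x\<bar> + \<bar>v y\<bar>) * cutoff_kernel s p R (x - y))"
      by (intro ennreal_leI) simp
    also have "\<dots> = g x * H (x - y) + g y * H (x - y)"
      by (simp add: g_def H_def ennreal_mult cutoff_kernel_nonneg distrib_right)
    finally show ?thesis .
  qed
  then have "(\<integral>\<^sup>+ z. ennreal ((\<bar>v (fst z)\<bar> + \<bar>v (snd z)\<bar>) * \<bar>cutoff R (fst z) - cutoff R (snd z)\<bar> powr p
           / norm (fst z - snd z) powr (real DIM('a) + s * p)) \<partial>(lebesgue \<Otimes>\<^sub>M lebesgue))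
      \<le> (\<integral>\<^sup>+ z. g (fst z) * H (fst z - snd z) + g (snd z) * H (fst z - snd z) \<partial>(lebesgue \<Otimes>\<^sub>M lebesgue))"
    by (intro nn_integral_mono)
  also have "\<dots> = (\<integral>\<^sup>+ z. g (fst z) * H (fst z - snd z) \<partial>(lebesgue \<Otimes>\<^sub>M lebesgue))
      + (\<integral>\<^sup>+ z. g (snd z) * H (fst z - snd z) \<partial>(lebesgue \<Otimes>\<^sub>M lebesgue))"
    using m by (intro nn_integral_add borel_measurable_times_ennreal)
  also have "\<dots> = 2 * (\<integral>\<^sup>+ x. ennreal \<bar>v x\<bar> \<partial>lebesgue) * cutoff_mass TYPE('a) s p R"
    by (simp add: nn_integral_pair_convolution[OF H g] g_def[symmetric] cutoff_mass_def H_def[symmetric] mult_2 distrib_right)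
  finally show ?thesis .
qed

text \<open>The weighted estimate is applied with the indicator of the ball of radius
  \<open>R\<close> as weight: wherever the difference is nonzero, one of the two points lies in the
  ball and the weight is at least 1. The result makes the cutoff admissible as a test function and
  the coefficient of \<delta> finite.\<close>

lemma cutoff_energy_finite:
  assumes "0 < s" "s < 1" "p > 0" "R \<ge> 1"
  shows "(\<integral>\<^sup>+ z. ennreal (\<bar>cutoff R (fst z) - cutoff R (snd z)\<bar> powr p
           / norm (fst z - snd z) powr (real DIM('a) + s * p)) \<partial>(lebesgue \<Otimes>\<^sub>M (lebesgue::'a::euclidean_space measure))) < \<infinity>"
    (is "?I < \<infinity>")
proof -
  have R: "R > 0" using assms by simp
  define v where "v = (\<lambda>x::'a. indicator (ball 0 R) x :: real)"
  have v: "v \<in> borel_measurable lebesgue" unfolding v_def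
    by (intro borel_measurable_indicator) auto
  have le: "\<bar>cutoff R x - cutoff R y\<bar> powr p \<le> (\<bar>v x\<bar> + \<bar>v y\<bar>) * \<bar>cutoff R x - cutoff R y\<bar> powr p" for x y :: 'a
  proof (cases "norm x < R \<or> norm y < R")
    case True
    then have "1 \<le> \<bar>v x\<bar> + \<bar>v y\<bar>" by (auto simp: v_def indicator_def)
    then show ?thesis using mult_right_mono[of 1 "\<bar>v x\<bar> + \<bar>v y\<bar>" "\<bar>cutoff R x - cutoff R y\<bar> powr p"] by simp
  next
    case False
    then show ?thesis using cutoff_eq_0[OF R, of x] cutoff_eq_0[OF R, of y] by simp
  qed
  have "?I \<le> (\<integral>\<^sup>+ z. ennreal ((\<bar>v (fst z)\<bar> + \<bar>v (snd z)\<bar>) * \<bar>cutoff R (fst z) - cutoff R (snd z)\<bar> powr p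
           / norm (fst z - snd z) powr (real DIM('a) + s * p)) \<partial>(lebesgue \<Otimes>\<^sub>M lebesgue))"
    using le by (intro nn_integral_mono ennreal_leI divide_right_mono) auto
  also have "\<dots> \<le> 2 * (\<integral>\<^sup>+ x. ennreal \<bar>v x\<bar> \<partial>lebesgue) * cutoff_mass TYPE('a) s p R"
    by (rule nn_integral_weighted_cutoff[OF R \<open>p > 0\<close> v])
  also have "(\<integral>\<^sup>+ x. ennreal \<bar>v x\<bar> \<partial>lebesgue) = emeasure lebesgue (ball (0::'a) R)"
    by (simp add: v_def ennreal_indicator)
  also have "2 * emeasure lebesgue (ball (0::'a) R) * cutoff_mass TYPE('a) s p R < \<infinity>"
    using cutoff_mass_finite[OF assms, where 'a='a] emeasure_lborel_ball_finite[of "0::'a" R]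
    by (simp add: ennreal_mult_less_top)
  finally show ?thesis .
qed

section \<open>Decay of regularised functionals along the flow\<close>

definition reg_functional :: "('a::euclidean_space \<Rightarrow> real) \<Rightarrow> real \<Rightarrow> real \<Rightarrow> real \<Rightarrow> ('a \<Rightarrow> real) \<Rightarrow> real" where
  "reg_functional \<phi> \<eta> \<kappa> \<delta> f = (\<integral>x. \<phi> x * f x \<partial>lebesgue) + \<eta> * (\<integral>x. reg_power \<kappa> \<delta> (f x) \<partial>lebesgue)"

definition reg_gradient :: "('a::euclidean_space \<Rightarrow> real) \<Rightarrow> real \<Rightarrow> real \<Rightarrow> real \<Rightarrow> ('a \<Rightarrow> real) \<Rightarrow> 'a \<Rightarrow> real" where
  "reg_gradient \<phi> \<eta> \<kappa> \<delta> f x = \<phi> x + \<eta> * reg_power_deriv \<kappa> \<delta> (f x)"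

section \<open>Regularity of the functional and admissibility of its gradient\<close>

lemma reg_power_measurable [measurable]: "reg_power \<kappa> \<delta> \<in> borel_measurable borel"
  "reg_power_deriv \<kappa> \<delta> \<in> borel_measurable borel"
  unfolding reg_power_def[abs_def] reg_power_deriv_def[abs_def] by measurable

lemma reg_power_integrable:
  fixes f :: "'a::euclidean_space \<Rightarrow> real"
  assumes kappa: "1 \<le> \<kappa>" "\<kappa> \<le> 2" and delta: "\<delta> > 0" and f: "f \<in> Lq 2"
  shows "integrable lebesgue (\<lambda>x. reg_power \<kappa> \<delta> (f x))"
proof (rule Bochner_Integration.integrable_bound)
  show "integrable lebesgue (\<lambda>x. 2 * \<delta> powr (\<kappa> - 2) * (f x)\<^sup>2)" using f by (simp add: Lq_2_iff)
  show "(\<lambda>x. reg_power \<kappa> \<delta> (f x)) \<in> borel_measurable lebesgue"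
    using f by (auto simp: Lq_2_iff intro!: measurable_compose[OF _ reg_power_measurable(1)])
  show "AE x in lebesgue. norm (reg_power \<kappa> \<delta> (f x)) \<le> norm (2 * \<delta> powr (\<kappa> - 2) * (f x)\<^sup>2)"
    using reg_power_nonneg[OF kappa delta] reg_power_le_quadratic[OF kappa delta] by auto
qed

lemma reg_power_deriv_Lq_2:
  fixes f :: "'a::euclidean_space \<Rightarrow> real"
  assumes kappa: "1 \<le> \<kappa>" "\<kappa> \<le> 2" and delta: "\<delta> > 0" and f: "f \<in> Lq 2"
  shows "(\<lambda>x. reg_power_deriv \<kappa> \<delta> (f x)) \<in> Lq 2"
proof (rule Lq_2_dominated[OF f])
  show "(\<lambda>x. reg_power_deriv \<kappa> \<delta> (f x)) \<in> borel_measurable lebesgue"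
    using f by (auto simp: Lq_2_iff intro!: measurable_compose[OF _ reg_power_measurable(2)])
  show "\<bar>reg_power_deriv \<kappa> \<delta> (f x)\<bar> \<le> 2 * \<delta> powr (\<kappa> - 2) * \<bar>f x\<bar>" for x
    using reg_power_deriv_Lipschitz[OF kappa delta, of "f x" 0] by (simp add: reg_power_zero[OF kappa delta])
qed

context
  fixes \<kappa> \<delta> \<eta> :: real and \<phi> :: "'a::euclidean_space \<Rightarrow> real"
  assumes kappa: "1 \<le> \<kappa>" "\<kappa> \<le> 2" and delta: "\<delta> > 0" and eta: "\<eta> > 0" and phi: "\<phi> \<in> Lq 2"
begin

lemma reg_gradient_Lq_2: "f \<in> Lq 2 \<Longrightarrow> reg_gradient \<phi> \<eta> \<kappa> \<delta> f \<in> Lq 2"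
  unfolding reg_gradient_def[abs_def] by (intro Lq_2_add Lq_2_cmult phi reg_power_deriv_Lq_2 kappa delta)

text \<open>The linear part is its own expansion, so only the integrated pointwise remainder of
  \<open>reg_power\<close> is left.\<close>

lemma reg_functional_taylor:
  assumes f: "f \<in> Lq 2" and g: "g \<in> Lq 2"
  shows "\<bar>reg_functional \<phi> \<eta> \<kappa> \<delta> g - reg_functional \<phi> \<eta> \<kappa> \<delta> f - (\<integral>x. reg_gradient \<phi> \<eta> \<kappa> \<delta> f x * (g x - f x) \<partial>lebesgue)\<bar>
     \<le> \<eta> * (2 * \<delta> powr (\<kappa> - 2)) * (\<integral>x. (g x - f x)\<^sup>2 \<partial>lebesgue)"
proof -
  define r where "r = (\<lambda>x. reg_power \<kappa> \<delta> (g x) - reg_power \<kappa> \<delta> (f x) - reg_power_deriv \<kappa> \<delta> (f x) * (g x - f x))"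
  have gf: "(\<lambda>x. g x - f x) \<in> Lq 2" by (rule Lq_2_diff[OF g f])
  have i: "integrable lebesgue (\<lambda>x. \<phi> x * f x)" "integrable lebesgue (\<lambda>x. \<phi> x * g x)"
    "integrable lebesgue (\<lambda>x. \<phi> x * (g x - f x))"
    "integrable lebesgue (\<lambda>x. reg_power \<kappa> \<delta> (g x))" "integrable lebesgue (\<lambda>x. reg_power \<kappa> \<delta> (f x))"
    "integrable lebesgue (\<lambda>x. reg_power_deriv \<kappa> \<delta> (f x) * (g x - f x))"
    by (intro integrable_mult_Lq_2 reg_power_integrable reg_power_deriv_Lq_2 kappa delta phi f g gf)+
  have ir: "integrable lebesgue r" unfolding r_def using i by simp
  have "(\<integral>x. reg_gradient \<phi> \<eta> \<kappa> \<delta> f x * (g x - f x) \<partial>lebesgue)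
      = (\<integral>x. \<phi> x * (g x - f x) + \<eta> * (reg_power_deriv \<kappa> \<delta> (f x) * (g x - f x)) \<partial>lebesgue)"
    by (intro Bochner_Integration.integral_cong) (auto simp: reg_gradient_def algebra_simps)
  also have "\<dots> = (\<integral>x. \<phi> x * (g x - f x) \<partial>lebesgue) + \<eta> * (\<integral>x. reg_power_deriv \<kappa> \<delta> (f x) * (g x - f x) \<partial>lebesgue)"
    using i by simp
  also have "(\<integral>x. \<phi> x * (g x - f x) \<partial>lebesgue) = (\<integral>x. \<phi> x * g x \<partial>lebesgue) - (\<integral>x. \<phi> x * f x \<partial>lebesgue)"
    using i by (simp add: right_diff_distrib)
  finally have "reg_functional \<phi> \<eta> \<kappa> \<delta> g - reg_functional \<phi> \<eta> \<kappa> \<delta> f - (\<integral>x. reg_gradient \<phi> \<eta> \<kappa> \<delta> f x * (g x - f x) \<partial>lebesgue)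
      = \<eta> * (\<integral>x. r x \<partial>lebesgue)"
  proof -
    assume e: "(\<integral>x. reg_gradient \<phi> \<eta> \<kappa> \<delta> f x * (g x - f x) \<partial>lebesgue)
      = (\<integral>x. \<phi> x * g x \<partial>lebesgue) - (\<integral>x. \<phi> x * f x \<partial>lebesgue) + \<eta> * (\<integral>x. reg_power_deriv \<kappa> \<delta> (f x) * (g x - f x) \<partial>lebesgue)"
    have "(\<integral>x. r x \<partial>lebesgue) = (\<integral>x. reg_power \<kappa> \<delta> (g x) \<partial>lebesgue) - (\<integral>x. reg_power \<kappa> \<delta> (f x) \<partial>lebesgue)
        - (\<integral>x. reg_power_deriv \<kappa> \<delta> (f x) * (g x - f x) \<partial>lebesgue)"
      unfolding r_def using i(4-6) by simp
    then show ?thesis unfolding e reg_functional_def by (simp add: right_diff_distrib)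
  qed
  moreover have "\<bar>\<integral>x. r x \<partial>lebesgue\<bar> \<le> (\<integral>x. 2 * \<delta> powr (\<kappa> - 2) * (g x - f x)\<^sup>2 \<partial>lebesgue)"
  proof (rule order_trans[OF integral_abs_bound], rule Bochner_Integration.integral_mono)
    show "integrable lebesgue (\<lambda>x. \<bar>r x\<bar>)" using ir by simp
    show "integrable lebesgue (\<lambda>x. 2 * \<delta> powr (\<kappa> - 2) * (g x - f x)\<^sup>2)" using gf by (simp add: Lq_2_iff)
    show "\<bar>r x\<bar> \<le> 2 * \<delta> powr (\<kappa> - 2) * (g x - f x)\<^sup>2" for x
      unfolding r_def by (rule reg_power_taylor[OF kappa delta])
  qed
  ultimately show ?thesis using eta by (simp add: abs_mult)
qed

text \<open>Composition with the Lipschitz function \<open>reg_power_deriv\<close> keeps the energy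
  finite. The Lipschitz constant involves \<open>\<delta> powr (\<kappa> - 2)\<close>, which is
  where the regularisation is needed.\<close>

lemma reg_gradient_energy_finite:
  assumes "p > 1" "v \<in> Lq 2" "frac_energy s p v < \<infinity>" "frac_energy s p \<phi> < \<infinity>"
  shows "frac_energy s p (reg_gradient \<phi> \<eta> \<kappa> \<delta> v) < \<infinity>"
proof -
  let ?M = "lebesgue \<Otimes>\<^sub>M (lebesgue :: 'a measure)" and ?\<psi> = "reg_gradient \<phi> \<eta> \<kappa> \<delta> v"
  let ?k = "\<lambda>z::'a\<times>'a. norm (fst z - snd z) powr (real DIM('a) + s * p)"
  let ?C = "\<eta> * (2 * \<delta> powr (\<kappa> - 2))"
  have pm: "\<phi> \<in> borel_measurable lebesgue" "v \<in> borel_measurable lebesgue" "?\<psi> \<in> borel_measurable lebesgue"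
    using phi assms(2) reg_gradient_Lq_2[OF assms(2)] by (auto simp: Lq_2_iff)
  have p0: "p > 0" using assms by simp
  have km: "?k \<in> borel_measurable ?M" by (rule borel_measurable_lebesgue_pair_diff) simp
  have i: "integrable ?M (\<lambda>z. \<bar>\<phi> (fst z) - \<phi> (snd z)\<bar> powr p / ?k z)"
    "integrable ?M (\<lambda>z. \<bar>v (fst z) - v (snd z)\<bar> powr p / ?k z)"
    using frac_energy_eq_integral(1)[OF pm(1) p0] frac_energy_eq_integral(1)[OF pm(2) p0] assms by auto
  have "integrable ?M (\<lambda>z. \<bar>?\<psi> (fst z) - ?\<psi> (snd z)\<bar> powr p / ?k z)"
  proof (rule Bochner_Integration.integrable_bound)
    show "integrable ?M (\<lambda>z. 2 powr p * (\<bar>\<phi> (fst z) - \<phi> (snd z)\<bar> powr p / ?k z)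
        + 2 powr p * ?C powr p * (\<bar>v (fst z) - v (snd z)\<bar> powr p / ?k z))"
      by (intro Bochner_Integration.integrable_add integrable_mult_right i)
    show "(\<lambda>z. \<bar>?\<psi> (fst z) - ?\<psi> (snd z)\<bar> powr p / ?k z) \<in> borel_measurable ?M"
      using borel_measurable_lebesgue_fst[OF pm(3)] borel_measurable_lebesgue_snd[OF pm(3)] km by measurable
    show "AE z in ?M. norm (\<bar>?\<psi> (fst z) - ?\<psi> (snd z)\<bar> powr p / ?k z)
        \<le> norm (2 powr p * (\<bar>\<phi> (fst z) - \<phi> (snd z)\<bar> powr p / ?k z)
          + 2 powr p * ?C powr p * (\<bar>v (fst z) - v (snd z)\<bar> powr p / ?k z))"
    proof (intro AE_I2)
      fix z :: "'a \<times> 'a"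
      let ?a = "\<bar>\<phi> (fst z) - \<phi> (snd z)\<bar>" and ?b = "\<bar>v (fst z) - v (snd z)\<bar>"
      have "\<bar>reg_power_deriv \<kappa> \<delta> (v (fst z)) - reg_power_deriv \<kappa> \<delta> (v (snd z))\<bar> \<le> 2 * \<delta> powr (\<kappa> - 2) * ?b"
        by (rule reg_power_deriv_Lipschitz[OF kappa delta])
      then have "\<eta> * \<bar>reg_power_deriv \<kappa> \<delta> (v (fst z)) - reg_power_deriv \<kappa> \<delta> (v (snd z))\<bar> \<le> \<eta> * (2 * \<delta> powr (\<kappa> - 2) * ?b)"
        using eta by (intro mult_left_mono) auto
      moreover have "?\<psi> (fst z) - ?\<psi> (snd z) = (\<phi> (fst z) - \<phi> (snd z))
          + \<eta> * (reg_power_deriv \<kappa> \<delta> (v (fst z)) - reg_power_deriv \<kappa> \<delta> (v (snd z)))"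
        by (simp add: reg_gradient_def algebra_simps)
      moreover have "\<bar>\<eta> * (reg_power_deriv \<kappa> \<delta> (v (fst z)) - reg_power_deriv \<kappa> \<delta> (v (snd z)))\<bar>
          = \<eta> * \<bar>reg_power_deriv \<kappa> \<delta> (v (fst z)) - reg_power_deriv \<kappa> \<delta> (v (snd z))\<bar>"
        using eta by (simp add: abs_mult)
      ultimately have "\<bar>?\<psi> (fst z) - ?\<psi> (snd z)\<bar> \<le> ?a + ?C * ?b" by (simp only: mult.assoc)
      also have "\<dots> \<le> 2 * max ?a (?C * ?b)"
        unfolding mult_2 by (intro add_mono max.cobounded1 max.cobounded2)
      finally have "\<bar>?\<psi> (fst z) - ?\<psi> (snd z)\<bar> powr p \<le> (2 * max ?a (?C * ?b)) powr p"
        using assms by (intro powr_mono2) auto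
      also have "\<dots> = 2 powr p * (max ?a (?C * ?b)) powr p" by (subst powr_mult) auto
      also have "\<dots> \<le> 2 powr p * (?a powr p + (?C * ?b) powr p)" by (auto simp: max_def)
      also have "(?C * ?b) powr p = ?C powr p * ?b powr p" using eta by (subst powr_mult) auto
      finally have "\<bar>?\<psi> (fst z) - ?\<psi> (snd z)\<bar> powr p / ?k z \<le> 2 powr p * (?a powr p + ?C powr p * ?b powr p) / ?k z"
        by (intro divide_right_mono) auto
      also have "\<dots> = 2 powr p * (?a powr p / ?k z) + 2 powr p * ?C powr p * (?b powr p / ?k z)"
        by (simp add: add_divide_distrib distrib_left mult.assoc)
      finally show "norm (\<bar>?\<psi> (fst z) - ?\<psi> (snd z)\<bar> powr p / ?k z)
        \<le> norm (2 powr p * (?a powr p / ?k z) + 2 powr p * ?C powr p * (?b powr p / ?k z))"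
        by (simp only: real_norm_def) (rule order_trans[OF _ abs_ge_self], simp)
    qed
  qed
  then show ?thesis using frac_energy_eq_integral(1)[OF pm(3) p0] by blast
qed

text \<open>At almost every time the derivative of the functional is the pairing of its gradient
  with the velocity, at most \<open>K\<close> by the subdifferential test. Subtracting
  \<open>K * t\<close> makes it nonpositive, and the monotonicity principle applies: the local
  Lipschitz bounds hold at positive times, and continuity carries the estimate down to time
  0.\<close>

lemma gradient_flow_functional_decay:
  assumes flow: "L2_gradient_flow s p v0 v" and "p > 1" and phiE: "frac_energy s p \<phi> < \<infinity>" and "T > 0" "K \<ge> 0"
    and le: "\<And>t x y. t > 0 \<Longrightarrow> - odd_power (p - 1) (v t x - v t y) *
        (reg_gradient \<phi> \<eta> \<kappa> \<delta> (v t) x - reg_gradient \<phi> \<eta> \<kappa> \<delta> (v t) y) \<le> b t (x, y)"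
    and b: "\<And>t. t > 0 \<Longrightarrow> (\<lambda>z. b t z / norm (fst z - snd z) powr (real DIM('a) + s * p)) \<in> borel_measurable (lebesgue \<Otimes>\<^sub>M lebesgue)"
      "\<And>t. t > 0 \<Longrightarrow> (\<integral>\<^sup>+ z. ennreal (b t z / norm (fst z - snd z) powr (real DIM('a) + s * p)) \<partial>(lebesgue \<Otimes>\<^sub>M lebesgue)) \<le> ennreal K"
      "\<And>t z. b t z \<ge> 0"
  shows "reg_functional \<phi> \<eta> \<kappa> \<delta> (v T) \<le> reg_functional \<phi> \<eta> \<kappa> \<delta> v0 + K * T"
proof -
  let ?F = "reg_functional \<phi> \<eta> \<kappa> \<delta>" and ?\<psi> = "reg_gradient \<phi> \<eta> \<kappa> \<delta>" and ?L = "\<eta> * (2 * \<delta> powr (\<kappa> - 2))"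
  have v: "\<And>t. t \<ge> 0 \<Longrightarrow> v t \<in> Lq 2" and v0: "AE x in lebesgue. v 0 x = v0 x" "v0 \<in> Lq 2"
    and cont: "\<And>t. t \<ge> 0 \<Longrightarrow> ((\<lambda>r. Lq_dist 2 (v r) (v t)) \<longlongrightarrow> 0) (at t within {0..})"
    and lip: "\<forall>\<delta>>0. \<exists>L. \<forall>r\<ge>\<delta>. \<forall>t\<ge>\<delta>. Lq_dist 2 (v r) (v t) \<le> ennreal ((L * \<bar>r - t\<bar>)\<^sup>2)"
    and ev: "AE t in lborel. t > 0 \<longrightarrow> (\<exists>w. w \<in> Lq 2 \<and>
             ((\<lambda>h. Lq_dist 2 (\<lambda>x. (v (t + h) x - v t x) / h) w) \<longlongrightarrow> 0) (at 0) \<and>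
             frac_subdiff s p (v t) (\<lambda>x. - w x))"
    using flow by (auto simp: L2_gradient_flow_def)
  note tay = reg_gradient_Lq_2 reg_functional_taylor
  have L0: "?L \<ge> 0" using eta by simp
  have "?F (v T) - K * T \<le> ?F (v 0) - K * 0"
  proof (rule AE_deriv_nonpos_imp_le[OF \<open>T > 0\<close>, where f = "\<lambda>t. ?F (v t) - K * t"])
    have "continuous_on {0..} (\<lambda>t. ?F (v t))"
      by (rule taylor_functional_continuous[OF tay]) (use v cont in auto)
    then show "continuous_on {0..T} (\<lambda>t. ?F (v t) - K * t)"
      by (intro continuous_intros) (auto elim: continuous_on_subset)
    show "\<exists>S B. open S \<and> x \<in> S \<and> (\<forall>y\<in>S. \<bar>?F (v y) - K * y - (?F (v x) - K * x)\<bar> \<le> B * \<bar>y - x\<bar>)"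
      if x: "0 < x" "x < T" for x
    proof -
      obtain S B where S: "open S" "x \<in> S" "\<And>y. y \<in> S \<Longrightarrow> \<bar>?F (v y) - ?F (v x)\<bar> \<le> B * \<bar>y - x\<bar>"
        using taylor_functional_pointwise_Lipschitz[OF tay v x(1) L0 lip] by blast
      have "\<bar>?F (v y) - K * y - (?F (v x) - K * x)\<bar> \<le> (B + K) * \<bar>y - x\<bar>" if "y \<in> S" for y
      proof -
        have "\<bar>K * (y - x)\<bar> = K * \<bar>y - x\<bar>" using \<open>K \<ge> 0\<close> by (simp add: abs_mult)
        then show ?thesis using S(3)[OF that] by (simp add: algebra_simps)
      qed
      with S show ?thesis by blast
    qed
    show "AE t in lborel. 0 < t \<and> t < T \<longrightarrow> (\<exists>d\<le>0. ((\<lambda>t. ?F (v t) - K * t) has_real_derivative d) (at t))"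
      using ev
    proof eventually_elim
      case (elim t)
      show ?case
      proof
        assume t: "0 < t \<and> t < T"
        with elim obtain w where w: "w \<in> Lq 2" "((\<lambda>h. Lq_dist 2 (\<lambda>x. (v (t + h) x - v t x) / h) w) \<longlongrightarrow> 0) (at 0)"
          "frac_subdiff s p (v t) (\<lambda>x. - w x)" by auto
        have D: "((\<lambda>t. ?F (v t)) has_real_derivative (\<integral>x. ?\<psi> (v t) x * w x \<partial>lebesgue)) (at t)"
          by (rule taylor_functional_DERIV[OF tay v _ w(1,2)]) (use t in auto)
        have vt: "v t \<in> Lq 2" "frac_energy s p (v t) < \<infinity>" using w(3) by (auto simp: frac_subdiff_def)
        have "(\<integral>x. ?\<psi> (v t) x * w x \<partial>lebesgue) \<le> K"
          by (rule frac_subdiff_test[OF \<open>p > 1\<close> w(3) reg_gradient_Lq_2[OF vt(1)] reg_gradient_energy_finite[OF \<open>p > 1\<close> vt phiE] le b(1,2,3) \<open>K \<ge> 0\<close>])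
             (use t in auto)
        moreover have "((\<lambda>t. ?F (v t) - K * t) has_real_derivative (\<integral>x. ?\<psi> (v t) x * w x \<partial>lebesgue) - K) (at t)"
          by (auto intro!: derivative_eq_intros D)
        ultimately show "\<exists>d\<le>0. ((\<lambda>t. ?F (v t) - K * t) has_real_derivative d) (at t)"
          by (intro exI conjI) (auto simp: algebra_simps)
      qed
    qed
  qed
  \<comment> \<open>The initial condition holds only almost everywhere, so the functional is
    compared through its integrals.\<close>
  moreover have "?F (v 0) = ?F v0"
  proof -
    have m: "v 0 \<in> borel_measurable lebesgue" "v0 \<in> borel_measurable lebesgue" "\<phi> \<in> borel_measurable lebesgue"
      using v[of 0] v0 phi by (auto simp: Lq_2_iff)
    have "(\<integral>x. \<phi> x * v 0 x \<partial>lebesgue) = (\<integral>x. \<phi> x * v0 x \<partial>lebesgue)"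
      using m v0(1) by (intro integral_cong_AE) auto
    moreover have "(\<integral>x. reg_power \<kappa> \<delta> (v 0 x) \<partial>lebesgue) = (\<integral>x. reg_power \<kappa> \<delta> (v0 x) \<partial>lebesgue)"
      using v0(1) m by (intro integral_cong_AE) (auto intro!: measurable_compose[OF _ reg_power_measurable(1)])
    ultimately show ?thesis by (simp add: reg_functional_def)
  qed
  ultimately show ?thesis by simp
qed

end

section \<open>Conservation of mass\<close>

lemma zero_function_energy: "frac_energy s p (\<lambda>x. 0) < \<infinity>"
  by (simp add: frac_energy_def)

text \<open>With exponent 1 and zero linear part the tested expression is nonpositive by
  monotonicity, so the decay estimate holds with \<open>K = 0\<close>. The left side is a
  nonnegative integral because finiteness of the L^1 norm at time \<open>t\<close> is part of the
  claim.\<close>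

lemma gradient_flow_L1_bound:
  fixes v0 :: "'a::euclidean_space \<Rightarrow> real"
  assumes flow: "L2_gradient_flow s p v0 v" and "p > 1" and v0: "v0 \<in> Lq 1" and "t > 0"
  shows "(\<integral>\<^sup>+ x. ennreal \<bar>v t x\<bar> \<partial>lebesgue) \<le> ennreal (\<integral>x. \<bar>v0 x\<bar> \<partial>lebesgue)"
proof -
  define \<delta> where "\<delta> = (\<lambda>n. inverse (real (Suc n)))"
  have d0: "\<delta> n > 0" for n by (simp add: \<delta>_def)
  have k: "1 \<le> (1::real)" "(1::real) \<le> 2" by auto
  have z: "(\<lambda>x::'a. 0) \<in> Lq 2" by (simp add: Lq_2_iff)
  have vt: "v t \<in> Lq 2" "v0 \<in> Lq 2" using flow \<open>t > 0\<close> by (auto simp: L2_gradient_flow_def)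
  have vm: "v t \<in> borel_measurable lebesgue" using vt by (simp add: Lq_2_iff)
  let ?j = "\<lambda>n. reg_power 1 (\<delta> n)"
  have j0: "?j n r \<ge> 0" and j1: "?j n r \<le> \<bar>r\<bar>" for n r
    using reg_power_nonneg[OF k d0[of n]] reg_power_le_abs_powr[OF k d0[of n], of r] by auto
  have "(\<integral>x. ?j n (v t x) \<partial>lebesgue) \<le> (\<integral>x. ?j n (v0 x) \<partial>lebesgue)" for n
  proof -
    have "reg_functional (\<lambda>x. 0) 1 1 (\<delta> n) (v t) \<le> reg_functional (\<lambda>x. 0) 1 1 (\<delta> n) v0 + 0 * t"
    proof (rule gradient_flow_functional_decay[OF k d0 _ z flow \<open>p > 1\<close> _ \<open>t > 0\<close>, where b = "\<lambda>_ _. 0"])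
      show "frac_energy s p (\<lambda>x::'a. 0) < \<infinity>" by (rule zero_function_energy)
      show "- odd_power (p - 1) (v r x - v r y) *
          (reg_gradient (\<lambda>x. 0) 1 1 (\<delta> n) (v r) x - reg_gradient (\<lambda>x. 0) 1 1 (\<delta> n) (v r) y) \<le> 0" for r x y
        using odd_power_mult_reg_power_deriv[OF k d0[of n] \<open>p > 1\<close>, of "v r x" "v r y"]
        by (simp add: reg_gradient_def)
    qed auto
    then show ?thesis by (simp add: reg_functional_def)
  qed
  also have "(\<integral>x. ?j n (v0 x) \<partial>lebesgue) \<le> (\<integral>x. \<bar>v0 x\<bar> \<partial>lebesgue)" for n
    using j1 v0 by (intro Bochner_Integration.integral_mono reg_power_integrable[OF k d0 vt(2)]) (auto simp: Lq_1_iff)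
  finally have le: "(\<integral>x. ?j n (v t x) \<partial>lebesgue) \<le> (\<integral>x. \<bar>v0 x\<bar> \<partial>lebesgue)" for n .
  have le': "(\<integral>\<^sup>+ x. ennreal (?j n (v t x)) \<partial>lebesgue) \<le> ennreal (\<integral>x. \<bar>v0 x\<bar> \<partial>lebesgue)" for n
    using le[of n] j0 by (subst nn_integral_eq_integral) (auto intro!: reg_power_integrable[OF k d0 vt(1)] ennreal_leI)
  have lim: "(\<lambda>n. ennreal (?j n r)) \<longlonglongrightarrow> ennreal \<bar>r\<bar>" for r
  proof (rule tendsto_ennrealI, rule tendsto_sandwich)
    have "\<delta> \<longlonglongrightarrow> 0" unfolding \<delta>_def by (rule LIMSEQ_inverse_real_of_nat)
    then show "(\<lambda>n. \<bar>r\<bar> - \<delta> n) \<longlonglongrightarrow> \<bar>r\<bar>" using tendsto_diff[OF tendsto_const[of "\<bar>r\<bar>"]] by force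
    show "(\<lambda>n. \<bar>r\<bar>) \<longlonglongrightarrow> \<bar>r\<bar>" by simp
  qed (use reg_power_1_ge[OF d0] j1 in auto)
  \<comment> \<open>Fatou's lemma as \<delta> tends to 0: the approximants converge pointwise and
    their integrals share one bound.\<close>
  have "(\<integral>\<^sup>+ x. ennreal \<bar>v t x\<bar> \<partial>lebesgue) = (\<integral>\<^sup>+ x. liminf (\<lambda>n. ennreal (?j n (v t x))) \<partial>lebesgue)"
    using lim_imp_Liminf[OF _ lim] by (intro nn_integral_cong) simp
  also have "\<dots> \<le> liminf (\<lambda>n. \<integral>\<^sup>+ x. ennreal (?j n (v t x)) \<partial>lebesgue)"
    using vm by (intro nn_integral_liminf measurable_compose[OF _ measurable_ennreal] measurable_compose[OF _ reg_power_measurable(1)])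
  also have "\<dots> \<le> liminf (\<lambda>n::nat. ennreal (\<integral>x. \<bar>v0 x\<bar> \<partial>lebesgue))"
    by (intro Liminf_mono always_eventually allI le')
  also have "\<dots> = ennreal (\<integral>x. \<bar>v0 x\<bar> \<partial>lebesgue)" by (simp add: Liminf_const)
  finally show ?thesis .
qed

text \<open>The sign \<sigma> allows mass to be bounded from both sides. The term
  \<open>\<delta> * E\<close> is kept apart because \<open>E\<close> depends on \<open>R\<close> but
  not on \<delta>, and everything else on the right is free of \<delta>.\<close>

lemma gradient_flow_cutoff_mass_bound:
  fixes v0 :: "'a::euclidean_space \<Rightarrow> real"
  assumes s: "0 < s" "s < 1" and p: "p > 2" and flow: "L2_gradient_flow s p v0 v" and v0: "v0 \<in> Lq 1"
    and "T > 0" "R \<ge> 1" "\<eta> > 0" "\<delta> > 0" and \<sigma>: "\<bar>\<sigma>\<bar> = 1"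
  defines "c \<equiv> (\<eta> * (1 - 1 / (p - 1))) powr (1 - p)"
  defines "E \<equiv> enn2real (\<integral>\<^sup>+ z. ennreal (\<bar>cutoff R (fst z) - cutoff R (snd z)\<bar> powr p
           / norm (fst z - snd z) powr (real DIM('a) + s * p)) \<partial>(lebesgue \<Otimes>\<^sub>M (lebesgue::'a measure)))"
  shows "\<sigma> * ((\<integral>x. cutoff R x * v T x \<partial>lebesgue) - (\<integral>x. cutoff R x * v0 x \<partial>lebesgue))
    \<le> \<eta> * (\<integral>x. \<bar>v0 x\<bar> + (v0 x)\<^sup>2 \<partial>lebesgue)
      + c * (2 * (\<integral>x. \<bar>v0 x\<bar> \<partial>lebesgue) * enn2real (cutoff_mass TYPE('a) s p R) + \<delta> * E) * T"
proof -
  define \<kappa> where "\<kappa> = 2 - 1 / (p - 1)"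
  have k: "1 \<le> \<kappa>" "\<kappa> \<le> 2" using p by (auto simp: \<kappa>_def field_simps)
  have p1: "p > 1" "p > 0" and R: "R > 0" using p \<open>R \<ge> 1\<close> by auto
  define \<phi> where "\<phi> = (\<lambda>x::'a. \<sigma> * cutoff R x)"
  have phi: "\<phi> \<in> Lq 2" unfolding \<phi>_def by (intro Lq_2_cmult cutoff_Lq_2 R)
  define D where "D = (\<lambda>z::'a \<times> 'a. \<bar>cutoff R (fst z) - cutoff R (snd z)\<bar> powr p)"
  define k0 where "k0 = (\<lambda>z::'a \<times> 'a. norm (fst z - snd z) powr (real DIM('a) + s * p))"
  let ?M = "lebesgue \<Otimes>\<^sub>M (lebesgue :: 'a measure)"
  let ?m = "enn2real (cutoff_mass TYPE('a) s p R)" and ?I = "\<integral>x. \<bar>v0 x\<bar> \<partial>lebesgue"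
  have E: "(\<integral>\<^sup>+ z. ennreal (D z / k0 z) \<partial>?M) = ennreal E"
    using cutoff_energy_finite[OF s p1(2) \<open>R \<ge> 1\<close>, where 'a='a] by (simp add: E_def D_def k0_def)
  have E0: "E \<ge> 0" by (simp add: E_def)
  have Dphi: "\<bar>\<phi> x - \<phi> y\<bar> powr p = D (x, y)" for x y
    using \<sigma> by (simp add: \<phi>_def D_def abs_mult flip: right_diff_distrib)
  have phiE: "frac_energy s p \<phi> < \<infinity>"
    using E by (simp add: frac_energy_def Dphi k0_def ennreal_mult_less_top)
  have km: "k0 \<in> borel_measurable ?M" unfolding k0_def by (rule borel_measurable_lebesgue_pair_diff) simp
  have Dm: "D \<in> borel_measurable ?M" unfolding D_def
    using borel_measurable_lebesgue_fst[OF cutoff_measurable[of R]] borel_measurable_lebesgue_snd[OF cutoff_measurable[of R]]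
    by measurable
  have c0: "c \<ge> 0" by (simp add: c_def)
  \<comment> \<open>The remainder of \<open>dissipation_pointwise\<close>. Its weight splits into
    the part \<open>\<bar>v t x\<bar> + \<bar>v t y\<bar>\<close>, paid by the L^1 norm and the
    kernel mass, and the constant \<delta>, paid by the cutoff energy.\<close>
  define b where "b = (\<lambda>t z. c * ((\<bar>v t (fst z)\<bar> + \<bar>v t (snd z)\<bar> + \<delta>) * D z))"
  define K where "K = c * (2 * ?I * ?m + \<delta> * E)"
  have K0: "K \<ge> 0" unfolding K_def using c0 E0 \<open>\<delta> > 0\<close> by (intro mult_nonneg_nonneg add_nonneg_nonneg) auto
  have "reg_functional \<phi> \<eta> \<kappa> \<delta> (v T) \<le> reg_functional \<phi> \<eta> \<kappa> \<delta> v0 + K * T"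
  proof (rule gradient_flow_functional_decay[OF k \<open>\<delta> > 0\<close> \<open>\<eta> > 0\<close> phi flow p1(1) phiE \<open>T > 0\<close> K0, where b = b])
    show "- odd_power (p - 1) (v t x - v t y) *
          (reg_gradient \<phi> \<eta> \<kappa> \<delta> (v t) x - reg_gradient \<phi> \<eta> \<kappa> \<delta> (v t) y) \<le> b t (x, y)" for t x y
    proof -
      have "reg_gradient \<phi> \<eta> \<kappa> \<delta> (v t) x - reg_gradient \<phi> \<eta> \<kappa> \<delta> (v t) y
          = (\<phi> x - \<phi> y) + \<eta> * (reg_power_deriv \<kappa> \<delta> (v t x) - reg_power_deriv \<kappa> \<delta> (v t y))"
        by (simp add: reg_gradient_def algebra_simps)
      moreover have "\<kappa> - 1 = 1 - 1 / (p - 1)" by (simp add: \<kappa>_def)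
      ultimately show ?thesis
        using dissipation_pointwise[OF p \<open>\<eta> > 0\<close> \<open>\<delta> > 0\<close>, of "v t x" "v t y" "\<phi> x - \<phi> y"]
        by (simp only: \<kappa>_def[symmetric] Dphi b_def c_def fst_conv snd_conv)
    qed
    show "0 \<le> b t z" for t z unfolding b_def D_def using c0 \<open>\<delta> > 0\<close> by (intro mult_nonneg_nonneg) auto
    fix t :: real assume t: "t > 0"
    have vt: "v t \<in> Lq 2" using flow t by (auto simp: L2_gradient_flow_def)
    then have vm: "v t \<in> borel_measurable lebesgue" by (simp add: Lq_2_iff)
    note vm2 = borel_measurable_lebesgue_fst[OF vm] borel_measurable_lebesgue_snd[OF vm]
    have "(\<lambda>z. b t z / k0 z) \<in> borel_measurable ?M" unfolding b_def using vm2 Dm km by measurable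
    then show "(\<lambda>z. b t z / norm (fst z - snd z) powr (real DIM('a) + s * p)) \<in> borel_measurable ?M"
      by (simp only: k0_def)
    define f where "f = (\<lambda>z. (\<bar>v t (fst z)\<bar> + \<bar>v t (snd z)\<bar>) * D z / k0 z)"
    have fm: "f \<in> borel_measurable ?M" unfolding f_def using vm2 Dm km by measurable
    have f0: "f z \<ge> 0" "D z / k0 z \<ge> 0" for z by (auto simp: f_def D_def k0_def)
    have split: "ennreal (c * (x + \<delta> * y)) = ennreal c * (ennreal x + ennreal \<delta> * ennreal y)" if "x \<ge> 0" "y \<ge> 0" for x y
      using that c0 \<open>\<delta> > 0\<close> by (simp add: ennreal_mult)
    have "(\<integral>\<^sup>+ z. ennreal (b t z / k0 z) \<partial>?M) = (\<integral>\<^sup>+ z. ennreal c * (ennreal (f z) + ennreal \<delta> * ennreal (D z / k0 z)) \<partial>?M)"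
    proof (rule nn_integral_cong)
      fix z
      have "b t z / k0 z = c * (f z + \<delta> * (D z / k0 z))"
        by (simp add: b_def f_def divide_inverse algebra_simps)
      then show "ennreal (b t z / k0 z) = ennreal c * (ennreal (f z) + ennreal \<delta> * ennreal (D z / k0 z))"
        using split[OF f0] by (simp only:)
    qed
    also have "\<dots> = ennreal c * ((\<integral>\<^sup>+ z. ennreal (f z) \<partial>?M) + ennreal \<delta> * (\<integral>\<^sup>+ z. ennreal (D z / k0 z) \<partial>?M))"
      using fm Dm km by (simp add: nn_integral_cmult nn_integral_add)
    also have "\<dots> \<le> ennreal c * (2 * ennreal ?I * ennreal ?m + ennreal \<delta> * ennreal E)"
    proof (intro mult_left_mono add_mono)
      have "(\<integral>\<^sup>+ z. ennreal (f z) \<partial>?M) \<le> 2 * (\<integral>\<^sup>+ x. ennreal \<bar>v t x\<bar> \<partial>lebesgue) * cutoff_mass TYPE('a) s p R"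
        unfolding f_def D_def k0_def by (rule nn_integral_weighted_cutoff[OF R p1(2) vm])
      also have "\<dots> \<le> 2 * ennreal ?I * cutoff_mass TYPE('a) s p R"
        by (intro mult_right_mono mult_left_mono gradient_flow_L1_bound[OF flow p1(1) v0 t]) auto
      also have "cutoff_mass TYPE('a) s p R = ennreal ?m"
        using cutoff_mass_finite[OF s p1(2) \<open>R \<ge> 1\<close>, where 'a='a] by simp
      finally show "(\<integral>\<^sup>+ z. ennreal (f z) \<partial>?M) \<le> 2 * ennreal ?I * ennreal ?m" .
    qed (use E in auto)
    also have "\<dots> = ennreal K"
    proof -
      have "2 * ennreal ?I * ennreal ?m = ennreal (2 * ?I * ?m)"
        by (simp add: ennreal_mult flip: ennreal_numeral)
      moreover have "0 \<le> 2 * ?I * ?m" by simp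
      ultimately show ?thesis unfolding K_def using split[of "2 * ?I * ?m" E] E0 by (simp only:)
    qed
    finally show "(\<integral>\<^sup>+ z. ennreal (b t z / norm (fst z - snd z) powr (real DIM('a) + s * p)) \<partial>?M) \<le> ennreal K"
      by (simp add: k0_def)
  qed
  moreover have "(\<integral>x. \<phi> x * f x \<partial>lebesgue) = \<sigma> * (\<integral>x. cutoff R x * f x \<partial>lebesgue)" for f
    by (simp add: \<phi>_def mult.assoc)
  \<comment> \<open>The convex part of the functional is discarded at time \<open>T\<close> by its
    sign and bounded at time 0 uniformly in \<delta>.\<close>
  moreover have "0 \<le> \<eta> * (\<integral>x. reg_power \<kappa> \<delta> (v T x) \<partial>lebesgue)"
    using \<open>\<eta> > 0\<close> reg_power_nonneg[OF k \<open>\<delta> > 0\<close>] by simp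
  moreover have "\<eta> * (\<integral>x. reg_power \<kappa> \<delta> (v0 x) \<partial>lebesgue) \<le> \<eta> * (\<integral>x. \<bar>v0 x\<bar> + (v0 x)\<^sup>2 \<partial>lebesgue)"
  proof (intro mult_left_mono Bochner_Integration.integral_mono)
    have "v0 \<in> Lq 2" using flow by (auto simp: L2_gradient_flow_def)
    then show "integrable lebesgue (\<lambda>x. reg_power \<kappa> \<delta> (v0 x))" "integrable lebesgue (\<lambda>x. \<bar>v0 x\<bar> + (v0 x)\<^sup>2)"
      using reg_power_integrable[OF k \<open>\<delta> > 0\<close>] v0 by (auto simp: Lq_2_iff Lq_1_iff)
  qed (use \<open>\<eta> > 0\<close> reg_power_le[OF k \<open>\<delta> > 0\<close>] in auto)
  ultimately show ?thesis unfolding reg_functional_def K_def by (simp add: right_diff_distrib)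
qed

lemma cutoff_integral_tendsto:
  fixes f :: "'a::euclidean_space \<Rightarrow> real"
  assumes "integrable lebesgue f"
  shows "(\<lambda>n. \<integral>x. cutoff (real (Suc n)) x * f x \<partial>lebesgue) \<longlonglongrightarrow> (\<integral>x. f x \<partial>lebesgue)"
proof (rule integral_dominated_convergence[where w = "\<lambda>x. \<bar>f x\<bar>"])
  show "(\<lambda>x. cutoff (real (Suc n)) x * f x) \<in> borel_measurable lebesgue" for n
    using assms by (intro borel_measurable_times cutoff_measurable) auto
  show "AE x in lebesgue. norm (cutoff (real (Suc n)) x * f x) \<le> \<bar>f x\<bar>" for n
  proof (intro AE_I2)
    fix x :: 'a
    show "norm (cutoff (real (Suc n)) x * f x) \<le> \<bar>f x\<bar>"
      using cutoff_bounds[of "real (Suc n)" x] by (simp add: abs_mult mult_left_le_one_le)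
  qed
  show "AE x in lebesgue. (\<lambda>n. cutoff (real (Suc n)) x * f x) \<longlonglongrightarrow> f x"
  proof (intro AE_I2)
    fix x :: 'a
    show "(\<lambda>n. cutoff (real (Suc n)) x * f x) \<longlonglongrightarrow> f x"
      using tendsto_mult[OF cutoff_tendsto[of x] tendsto_const[of "f x"]] by simp
  qed
qed (use assms in auto)

lemma gradient_flow_L1:
  assumes "L2_gradient_flow s p v0 v" "p > 1" "v0 \<in> Lq 1" "t > 0"
  shows "v t \<in> Lq 1"
proof -
  have "v t \<in> borel_measurable lebesgue" using assms by (auto simp: L2_gradient_flow_def Lq_2_iff)
  moreover have "(\<integral>\<^sup>+ x. ennreal \<bar>v t x\<bar> \<partial>lebesgue) < \<infinity>"
    using order_le_less_trans[OF gradient_flow_L1_bound[OF assms] ennreal_less_top] by simp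
  ultimately show ?thesis by (simp add: Lq_def)
qed

text \<open>Three limits in this order: \<delta> to 0 for each \<open>n\<close>, which removes the
  cutoff energy; \<open>n\<close> to infinity for each \<eta>, since \<open>c\<close> blows up as
  \<eta> tends to 0; then \<eta> to 0, which removes the initial functional
  \<open>J\<close>.\<close>

theorem gradient_flow_mass_conservation:
  fixes v0 :: "'a::euclidean_space \<Rightarrow> real"
  assumes s: "0 < s" "s < 1" and p: "p > 2" and flow: "L2_gradient_flow s p v0 v" and v0: "v0 \<in> Lq 1" and "t > 0"
  shows "(\<integral>x. v t x \<partial>lebesgue) = (\<integral>x. v0 x \<partial>lebesgue)"
proof -
  have p1: "p > 1" "p > 0" using p by auto
  have iv: "integrable lebesgue (v t)" "integrable lebesgue v0"
    using gradient_flow_L1[OF flow p1(1) v0 \<open>t > 0\<close>] v0 by (auto simp: Lq_1_iff)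
  define J where "J = (\<integral>x. \<bar>v0 x\<bar> + (v0 x)\<^sup>2 \<partial>lebesgue)"
  define I where "I = (\<integral>x. \<bar>v0 x\<bar> \<partial>lebesgue)"
  have J0: "J \<ge> 0" by (auto simp: J_def)
  define X where "X = (\<lambda>R. (\<integral>x. cutoff R x * v t x \<partial>lebesgue) - (\<integral>x. cutoff R x * v0 x \<partial>lebesgue))"
  define Y where "Y = (\<integral>x. v t x \<partial>lebesgue) - (\<integral>x. v0 x \<partial>lebesgue)"
  have X: "(\<lambda>n. X (real (Suc n))) \<longlonglongrightarrow> Y"
    unfolding X_def Y_def by (intro tendsto_diff cutoff_integral_tendsto iv)
  define m where "m = (\<lambda>n. enn2real (cutoff_mass TYPE('a) s p (real (Suc n))))"
  have m: "m \<longlonglongrightarrow> 0"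
    using tendsto_enn2real[OF cutoff_mass_tendsto[OF s p1(2), where 'a='a, unfolded ennreal_0[symmetric]]]
    by (simp add: m_def)
  have main: "\<sigma> * Y \<le> \<eta> * J" if \<sigma>: "\<bar>\<sigma>\<bar> = 1" and "\<eta> > 0" for \<sigma> \<eta> :: real
  proof -
    define c where "c = (\<eta> * (1 - 1 / (p - 1))) powr (1 - p)"
    have bound: "\<sigma> * X (real (Suc n)) \<le> \<eta> * J + c * (2 * I * m n) * t" for n
    proof -
      \<comment> \<open>The quantifier order records that the cutoff energy \<open>E\<close> is
        independent of \<delta>, as the limit in \<delta> requires.\<close>
      have "\<exists>E. \<forall>\<delta>>0. \<sigma> * X (real (Suc n)) \<le> \<eta> * J + c * (2 * I * m n + \<delta> * E) * t"
        unfolding X_def J_def I_def m_def c_def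
        by (intro exI allI impI, rule gradient_flow_cutoff_mass_bound[OF s p flow v0 \<open>t > 0\<close> _ \<open>\<eta> > 0\<close> _ \<sigma>]) auto
      then obtain E where E: "\<And>\<delta>. \<delta> > 0 \<Longrightarrow> \<sigma> * X (real (Suc n)) \<le> \<eta> * J + c * (2 * I * m n + \<delta> * E) * t"
        by blast
      have "(\<lambda>k. \<eta> * J + c * (2 * I * m n + inverse (real (Suc k)) * E) * t) \<longlonglongrightarrow> \<eta> * J + c * (2 * I * m n + 0 * E) * t"
        by (intro tendsto_add tendsto_mult tendsto_const LIMSEQ_inverse_real_of_nat)
      from LIMSEQ_le_const[OF this, of "\<sigma> * X (real (Suc n))"] E show ?thesis by simp
    qed
    have "(\<lambda>n. \<eta> * J + c * (2 * I * m n) * t) \<longlonglongrightarrow> \<eta> * J + c * (2 * I * 0) * t"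
      by (intro tendsto_add tendsto_mult tendsto_const m)
    from LIMSEQ_le[OF tendsto_mult[OF tendsto_const X] this] bound show ?thesis by simp
  qed
  have "\<bar>Y\<bar> \<le> e" if "e > 0" for e
  proof -
    \<comment> \<open>The summand 1 covers \<open>J = 0\<close>.\<close>
    define \<eta> where "\<eta> = e / (J + 1)"
    have "\<eta> > 0" using that J0 by (simp add: \<eta>_def)
    have "\<eta> * J \<le> e" using that J0 by (simp add: \<eta>_def field_simps)
    with main[of 1 \<eta>] main[of "-1" \<eta>] \<open>\<eta> > 0\<close> show ?thesis by simp
  qed
  then have "\<bar>Y\<bar> \<le> 0" by (rule field_le_epsilon) simp
  then show ?thesis by (simp add: Y_def)
qed

lemma Lq_dist_1_tendsto_imp_integral_tendsto:
  fixes f :: "'a::euclidean_space \<Rightarrow> real"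
  assumes "\<And>n. f' n \<in> Lq 1" "f \<in> Lq 1" "(\<lambda>n. Lq_dist 1 (f' n) f) \<longlonglongrightarrow> 0"
  shows "(\<lambda>n. \<integral>x. f' n x \<partial>lebesgue) \<longlonglongrightarrow> (\<integral>x. f x \<partial>lebesgue)"
proof -
  have i: "integrable lebesgue (f' n)" "integrable lebesgue f" for n using assms by (auto simp: Lq_1_iff)
  have "(\<lambda>n. \<integral>x. \<bar>f' n x - f x\<bar> \<partial>lebesgue) \<longlonglongrightarrow> 0"
    using assms by (simp add: Lq_dist_1_eq tendsto_ennreal_0_iff)
  then have "(\<lambda>n. (\<integral>x. f' n x \<partial>lebesgue) - (\<integral>x. f x \<partial>lebesgue)) \<longlonglongrightarrow> 0"
  proof (rule Lim_null_comparison[rotated], intro always_eventually allI)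
    fix n
    show "norm ((\<integral>x. f' n x \<partial>lebesgue) - (\<integral>x. f x \<partial>lebesgue)) \<le> (\<integral>x. \<bar>f' n x - f x\<bar> \<partial>lebesgue)"
      using integral_abs_bound[of lebesgue "\<lambda>x. f' n x - f x"] i by simp
  qed
  then show ?thesis by (simp add: LIM_zero_iff)
qed

theorem mainTheorem7:
  fixes s p :: real and u0 :: "'a::euclidean_space \<Rightarrow> real" and u :: "real \<Rightarrow> 'a \<Rightarrow> real"
  assumes "0 < s" "s < 1" "p > 2"
    and "u0 \<in> Lq 1"
    and "AE x in lebesgue. u0 x \<ge> 0"
    and "semigroup_solution_L1 s p u0 u"
    and "t > 0"
  shows "(\<integral>x. u t x \<partial>lebesgue) = (\<integral>x. u0 x \<partial>lebesgue)"
proof -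
  have ut: "u t \<in> Lq 1" using assms(6,7) by (auto simp: semigroup_solution_L1_def)
  from assms(6) obtain v0 v where
    v: "\<forall>n. v0 n \<in> Lq 1 \<and> v0 n \<in> Lq 2 \<and> L2_gradient_flow s p (v0 n) (v n)"
    and lim0: "(\<lambda>n. Lq_dist 1 (v0 n) u0) \<longlonglongrightarrow> 0"
    and limt: "\<forall>t\<ge>0. (\<lambda>n. Lq_dist 1 (v n t) (u t)) \<longlonglongrightarrow> 0"
    unfolding semigroup_solution_L1_def by blast
  have v1: "v0 n \<in> Lq 1" and flow: "L2_gradient_flow s p (v0 n) (v n)" for n using v by auto
  \<comment> \<open>The flow provides \<open>v n t\<close> only in L^2; its integrability, which
    turns \<open>Lq_dist 1\<close> into a difference of integrable functions, comes from the L^1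
    bound.\<close>
  have "(\<lambda>n. \<integral>x. v n t x \<partial>lebesgue) \<longlonglongrightarrow> (\<integral>x. u t x \<partial>lebesgue)"
    by (rule Lq_dist_1_tendsto_imp_integral_tendsto[OF gradient_flow_L1[OF flow _ v1 \<open>t > 0\<close>] ut])
       (use assms limt in auto)
  moreover have "(\<integral>x. v n t x \<partial>lebesgue) = (\<integral>x. v0 n x \<partial>lebesgue)" for n
    by (rule gradient_flow_mass_conservation[OF assms(1-3) flow v1 \<open>t > 0\<close>])
  ultimately have "(\<lambda>n. \<integral>x. v0 n x \<partial>lebesgue) \<longlonglongrightarrow> (\<integral>x. u t x \<partial>lebesgue)" by simp
  from LIMSEQ_unique[OF this Lq_dist_1_tendsto_imp_integral_tendsto[OF v1 assms(4) lim0]]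
  show ?thesis .
qed

end
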